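(* Let $X$ be a Banach space, let $\Phi,\Psi:X\to\mathbb R_+$ be convex continuous functions, neither identically zero, such that $\Psi$ is even, and let $d\ge1$, $j\in\{1,\dots,d\}$. Then $$|T_j|_{\Phi,\Psi}\le|\mathcal H^{\mathbb R}_X|_{\Phi,\Psi}.$$
   Context: All Banach spaces are real; $\mathbb R_+=[0,\infty)$. Put $\mathbb R^d_{j+}=\{x\in\mathbb R^d:x_j>0\}$. A step function on $\mathbb R^d_{j+}$ is a finite linear combination, with coefficients in $X$, of indicator functions of rectangles (of finite measure); a step function on $\mathbb R$ is a finite linear combination, with coefficients in $X$, of indicators of bounded intervals. For $f:\mathbb R^d_{j+}\to X$, $$T_jf(x)=\frac{\Gamma(\frac{d+1}{2})}{\pi^{(d+1)/2}}\int_{\mathbb R^d_{j+}}\frac{f(y)(x_j+y_j)}{|x+y|^{d+1}}\,dy,\qquad x\in\mathbb R^d_{j+},$$ and $|T_j|_{\Phi,\Psi}$ is the infimum of all $c\in[0,\infty]$ such that $\int_{\mathbb R^d_{j+}}\Psi(T_jf(x))\,dx\le c\int_{\mathbb R^d_{j+}}\Phi(f(x))\,dx$ for all step functions $f:\mathbb R^d_{j+}\to X$. For a step function $f:\mathbb R\to X$, $\mathcal H^{\mathbb R}_Xf(t)=\frac1\pi\,\mathrm{p.v.}\int_{\mathbb R}\frac{f(s)}{t-s}\,ds$, and $|\mathcal H^{\mathbb R}_X|_{\Phi,\Psi}$ is the infimum of all $c\in[0,\infty]$ such that $\int_{\mathbb R}\Psi(\mathcal H^{\mathbb R}_Xf(s))\,ds\le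 c\int_{\mathbb R}\Phi(f(s))\,ds$ for all step functions $f:\mathbb R\to X$. *)

theory Defs
  imports "HOL-Analysis.Analysis"
begin

definition pos_halfspace :: "'d::finite \<Rightarrow> (real ^ 'd) set" where
  "pos_halfspace j = {x. x $ j > 0}"

definition step_functions :: "'b set set \<Rightarrow> ('b \<Rightarrow> 'a::real_vector) set" where
  "step_functions \<R> = {f. \<exists>(n::nat) R c. (\<forall>k<n. R k \<in> \<R>) \<and>
     f = (\<lambda>x. \<Sum>k<n. indicator (R k) x *\<^sub>R c k)}"

text \<open>In \<open>real ^ 'd\<close>, \<^const>\<open>is_interval\<close> describes exactly the Cartesian products of \<open>d\<close> (open,
  closed, half-open, possibly degenerate or unbounded) intervals.\<close>

definition halfspace_rectangles :: "'d::finite \<Rightarrow> (real ^ 'd) set set" where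
  "halfspace_rectangles j =
     {R. is_interval R \<and> R \<subseteq> pos_halfspace j \<and> emeasure lborel R < \<infinity>}"

definition bounded_intervals :: "real set set" where
  "bounded_intervals = {I. is_interval I \<and> bounded I}"

text \<open>The vector-valued integrals are Henstock--Kurzweil integrals, because the library's Bochner
  integral needs a second countable target and the Banach space is arbitrary. They are applied to
  step functions only, where the integrand is bounded, has finite-dimensional range and vanishes
  outside a set of finite measure, so that both integrals agree.\<close>

definition T_op :: "'d::finite \<Rightarrow> (real ^ 'd \<Rightarrow> 'a::banach) \<Rightarrow> real ^ 'd \<Rightarrow> 'a" where
  "T_op j f x =
     (Gamma ((real CARD('d) + 1) / 2) / pi powr ((real CARD('d) + 1) / 2)) *\<^sub>R
     integral (pos_halfspace j)
       (\<lambda>y. ((x $ j + y $ j) / norm (x + y) ^ (CARD('d) + 1)) *\<^sub>R f y)"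

text \<open>For a step function the principal value exists except at finitely many \<open>t\<close> (the jumps), where
  \<^const>\<open>Lim\<close> is unspecified; this null set does not affect the integrals below.\<close>

definition hilbert_transform :: "(real \<Rightarrow> 'a::banach) \<Rightarrow> real \<Rightarrow> 'a" where
  "hilbert_transform f t =
     (1 / pi) *\<^sub>R Lim (at_right 0)
       (\<lambda>\<epsilon>. integral {s. \<bar>t - s\<bar> > \<epsilon>} (\<lambda>s. (1 / (t - s)) *\<^sub>R f s))"

text \<open>The conventions \<open>0 * \<infinity> = \<infinity> * 0 = 0\<close> of \<^typ>\<open>ennreal\<close> do not influence the value of this infimum
  (\<open>Inf {} = \<infinity>\<close>).\<close>

definition best_const ::
  "'b::euclidean_space set \<Rightarrow> ('b \<Rightarrow> 'a) set \<Rightarrow> (('b \<Rightarrow> 'a) \<Rightarrow> 'b \<Rightarrow> 'a)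
     \<Rightarrow> ('a \<Rightarrow> real) \<Rightarrow> ('a \<Rightarrow> real) \<Rightarrow> ennreal" where
  "best_const D S T \<Phi> \<Psi> = Inf {c. \<forall>f\<in>S.
     (\<integral>\<^sup>+x\<in>D. ennreal (\<Psi> (T f x)) \<partial>lborel) \<le> c * (\<integral>\<^sup>+x\<in>D. ennreal (\<Phi> (f x)) \<partial>lborel)}"

definition T_const :: "'d::finite \<Rightarrow> ('a::banach \<Rightarrow> real) \<Rightarrow> ('a \<Rightarrow> real) \<Rightarrow> ennreal" where
  "T_const j = best_const (pos_halfspace j) (step_functions (halfspace_rectangles j)) (T_op j)"

definition hilbert_const :: "('a::banach \<Rightarrow> real) \<Rightarrow> ('a \<Rightarrow> real) \<Rightarrow> ennreal" where
  "hilbert_const = best_const UNIV (step_functions bounded_intervals) hilbert_transform"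

end

theory Submission
  imports Defs "HOL-Probability.Distributions"
begin

text \<open>The proof is the method of rotations. For \<open>v\<close> distributed on \<open>{v. v $ j > 0}\<close> with density
  proportional to \<open>v $ j * exp (- (norm v)^2)\<close>, scaling and the Gamma integral show that \<open>T f x\<close> is the
  expectation of \<open>1 / pi\<close> times the integral of \<open>f (- x + s v) / s\<close> over \<open>s > 0\<close>, that is, of minus the
  Hilbert transform of \<open>f\<close> along the line through \<open>- x\<close> in direction \<open>v\<close>. A radially weighted
  density on the whole half-space avoids the surface measure of the sphere. Jensen's inequality
  bounds \<open>\<Psi> (T f x)\<close> by the expectation of \<open>\<Psi>\<close> of these directional transforms, and for fixed \<open>v\<close>
  Tonelli's theorem reduces the integral over \<open>x\<close> to the estimate for \<open>hilbert_transform\<close> on lines.\<close>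

subsection \<open>Intervals in Euclidean space\<close>

text \<open>An interval is the finite intersection of the preimages of its coordinate projections,
  and each projection is convex in the real line, hence a Borel set.\<close>

lemma is_interval_borel:
  fixes S :: "'b::euclidean_space set"
  assumes "is_interval S"
  shows "S \<in> sets borel"
proof -
  have proj: "(\<lambda>x. x \<bullet> i) ` S \<in> sets borel" for i
    using assms by (intro real_interval_borel_measurable)
      (simp add: is_interval_convex_1 is_interval_convex convex_linear_image bounded_linear.linear bounded_linear_inner_left)
  have "S = (\<Inter>i\<in>Basis. {x. x \<bullet> i \<in> (\<lambda>x. x \<bullet> i) ` S})"
    using mem_box_componentwiseI[OF assms] by blast
  also have "\<dots> \<in> sets borel"
  proof (intro sets.countable_INT'')
    fix i :: 'b
    have "(\<lambda>x. x \<bullet> i) -` ((\<lambda>x. x \<bullet> i) ` S) \<inter> space borel \<in> sets borel"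
      by (rule measurable_sets[OF _ proj]) simp
    then show "{x. x \<bullet> i \<in> (\<lambda>x. x \<bullet> i) ` S} \<in> sets borel"
      by (simp add: vimage_def)
  qed (auto simp: countable_finite)
  finally show ?thesis .
qed

text \<open>Translating \<open>a\<close> and \<open>b\<close> by the same small vector
  \<open>y - x\<close> keeps both in \<open>S\<close>, and \<open>y\<close> lies coordinatewise
  between the translates. So a whole ball around \<open>x\<close> stays in \<open>S\<close>.\<close>

lemma is_interval_interior:
  fixes S :: "'b::euclidean_space set"
  assumes "is_interval S"
  shows "is_interval (interior S)"
  unfolding is_interval_def
proof (intro ballI allI impI)
  fix a b x
  assume ab: "a \<in> interior S" "b \<in> interior S"
    and x: "\<forall>i\<in>Basis. a \<bullet> i \<le> x \<bullet> i \<and> x \<bullet> i \<le> b \<bullet> i \<or> b \<bullet> i \<le> x \<bullet> i \<and> x \<bullet> i \<le> a \<bullet> i"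
  obtain d e where d: "d > 0" "ball a d \<subseteq> S" and e: "e > 0" "ball b e \<subseteq> S"
    using ab unfolding mem_interior by blast
  have "y \<in> S" if y: "y \<in> ball x (min d e)" for y
  proof (rule mem_is_intervalI[OF assms])
    show "a + (y - x) \<in> S" "b + (y - x) \<in> S"
      using d(2) e(2) y by (auto simp: dist_norm norm_minus_commute)
    fix i :: 'b assume "i \<in> Basis"
    then show "(a + (y - x)) \<bullet> i \<le> y \<bullet> i \<and> y \<bullet> i \<le> (b + (y - x)) \<bullet> i \<or>
        (b + (y - x)) \<bullet> i \<le> y \<bullet> i \<and> y \<bullet> i \<le> (a + (y - x)) \<bullet> i"
      using x by (auto simp: inner_simps)
  qed
  then show "x \<in> interior S"
    using d(1) e(1) unfolding mem_interior by (intro exI[of _ "min d e"]) auto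
qed

text \<open>A nonempty open interval contains a box with positive sides. Stretching its
  \<open>i\<close>-th side between the coordinates of any two points of \<open>S\<close> stays
  inside \<open>S\<close>, so finite volume bounds the extent in direction \<open>i\<close>.
  Openness excludes unbounded degenerate intervals of measure zero.\<close>

lemma bounded_open_interval:
  fixes S :: "'b::euclidean_space set"
  assumes "open S" "is_interval S" "emeasure lborel S < \<infinity>"
  shows "bounded S"
proof (cases "S = {}")
  case False
  then obtain p where p: "p \<in> S" by auto
  obtain a b where ab: "p \<in> box a b" "cbox a b \<subseteq> S"
    using open_contains_cbox[OF assms(1) p] by metis
  have lt: "a \<bullet> k < b \<bullet> k" if "k \<in> Basis" for k
    using ab(1) that by (force simp: mem_box)
  have "a \<bullet> k \<le> a \<bullet> k \<and> a \<bullet> k \<le> b \<bullet> k" if "k \<in> Basis" for k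
    using lt[OF that] by simp
  then have aS: "a \<in> S"
    using ab(2) by (auto simp: mem_box)
  obtain m where m: "emeasure lborel S = ennreal m" "m \<ge> 0"
    using assms(3) by (cases "emeasure lborel S") auto
  have coord: "\<exists>B. \<forall>x\<in>S. \<bar>x \<bullet> i\<bar> \<le> B" if i: "i \<in> Basis" for i
  proof -
    \<comment> \<open>The volume of the cross-section of the box orthogonal to \<open>i\<close>; the
      extent of \<open>S\<close> along \<open>i\<close> is then at most
      \<open>m / K\<close>.\<close>
    define K where "K = (\<Prod>k\<in>Basis - {i}. b \<bullet> k - a \<bullet> k)"
    have K: "K > 0"
      unfolding K_def using lt by (intro prod_pos) auto
    have dist: "y \<bullet> i - x \<bullet> i \<le> m / K" if x: "x \<in> S" and y: "y \<in> S" for x y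
    proof (cases "x \<bullet> i \<le> y \<bullet> i")
      case True
      \<comment> \<open>The corners of the stretched box: the coordinates of \<open>a\<close> and
        \<open>b\<close>, except that the \<open>i\<close>-th ones come from \<open>x\<close> and
        \<open>y\<close>. Each coordinate is attained by a point of \<open>S\<close>, which puts
        both corners into the interval.\<close>
      define l where "l = (\<Sum>k\<in>Basis. (if k = i then x \<bullet> k else a \<bullet> k) *\<^sub>R k)"
      define u where "u = (\<Sum>k\<in>Basis. (if k = i then y \<bullet> k else b \<bullet> k) *\<^sub>R k)"
      have lk: "l \<bullet> k = (if k = i then x \<bullet> k else a \<bullet> k)" if "k \<in> Basis" for k
        using that unfolding l_def by (rule inner_sum_left_Basis)
      have uk: "u \<bullet> k = (if k = i then y \<bullet> k else b \<bullet> k)" if "k \<in> Basis" for k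
        using that unfolding u_def by (rule inner_sum_left_Basis)
      have lu: "l \<bullet> k \<le> u \<bullet> k" if "k \<in> Basis" for k
        using lk[OF that] uk[OF that] lt[OF that] True by auto
      have bS: "b \<in> S" using ab(2) lt by (force simp: mem_box)
      have "l \<in> S"
        by (rule mem_box_componentwiseI[OF assms(2)]) (use lk x aS in auto)
      moreover have "u \<in> S"
        by (rule mem_box_componentwiseI[OF assms(2)]) (use uk y bS in auto)
      ultimately have "cbox l u \<subseteq> S"
        using interval_subset_is_interval[OF assms(2)] by blast
      then have "emeasure lborel (cbox l u) \<le> ennreal m"
        using emeasure_mono[of "cbox l u" S lborel] is_interval_borel[OF assms(2)] m by simp
      moreover have "emeasure lborel (cbox l u) = ennreal (\<Prod>k\<in>Basis. (u - l) \<bullet> k)"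
        using lu by (rule emeasure_lborel_cbox)
      moreover have "(\<Prod>k\<in>Basis. (u - l) \<bullet> k) = (y \<bullet> i - x \<bullet> i) * K"
        unfolding K_def using i by (subst prod.remove[of _ i]) (auto simp: lk uk inner_diff_left intro!: prod.cong)
      ultimately have "(y \<bullet> i - x \<bullet> i) * K \<le> m"
        using m by simp
      then show ?thesis using K by (simp add: field_simps)
    next
      case False
      then show ?thesis using m K
        by (smt (verit) divide_nonneg_pos)
    qed
    have "\<bar>x \<bullet> i\<bar> \<le> \<bar>a \<bullet> i\<bar> + m / K" if "x \<in> S" for x
      using dist[OF that aS] dist[OF aS that] by linarith
    then show ?thesis by blast
  qed
  then obtain B where B: "\<And>i x. i \<in> Basis \<Longrightarrow> x \<in> S \<Longrightarrow> \<bar>x \<bullet> i\<bar> \<le> B i"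
    by metis
  have "norm x \<le> (\<Sum>i\<in>Basis. B i)" if "x \<in> S" for x
    using norm_le_l1[of x] sum_mono[of Basis "\<lambda>i. \<bar>x \<bullet> i\<bar>" B] B that by force
  then show ?thesis unfolding bounded_iff by blast
qed simp

subsection \<open>Jensen's inequality for finite linear combinations\<close>

text \<open>The space may be nonseparable, so the sum is never treated as a measurable vector-valued
  function. Rounding the last coefficient down to a multiple of \<open>1 / Suc m\<close> leaves
  countably many values. On each level set the induction hypothesis applies to a translate of
  \<open>G\<close>, and continuity of \<open>G\<close> allows the passage to the limit in
  \<open>m\<close>.\<close>

lemma borel_measurable_continuous_combination:
  fixes G :: "'a::real_normed_vector \<Rightarrow> real" and h :: "nat \<Rightarrow> 'b \<Rightarrow> real"
  assumes "\<And>k. k < n \<Longrightarrow> h k \<in> borel_measurable M" and "continuous_on UNIV G"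
  shows "(\<lambda>\<omega>. G (\<Sum>k<n. h k \<omega> *\<^sub>R c k)) \<in> borel_measurable M"
  using assms
proof (induction n arbitrary: G)
  case (Suc n)
  define q where "q m \<omega> = \<lfloor>real (Suc m) * h n \<omega>\<rfloor>" for m \<omega>
  define G' where "G' m i x = G (x + (of_int i / real (Suc m)) *\<^sub>R c n)" for m i x
  show ?case
  proof (rule borel_measurable_LIMSEQ_real)
    fix m
    have "continuous_on UNIV (G' m i)" for i
      unfolding G'_def by (intro continuous_on_compose2[OF Suc.prems(2)] continuous_intros) auto
    then have "(\<lambda>\<omega>. G' m i (\<Sum>k<n. h k \<omega> *\<^sub>R c k)) \<in> borel_measurable M" for i
      using Suc by simp
    moreover have "q m \<in> measurable M (count_space UNIV)"
      unfolding q_def using Suc.prems(1)[of n] by measurable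
    ultimately show "(\<lambda>\<omega>. G' m (q m \<omega>) (\<Sum>k<n. h k \<omega> *\<^sub>R c k)) \<in> borel_measurable M"
      by (rule measurable_compose_countable)
  next
    fix \<omega>
    have "(\<lambda>m. of_int (q m \<omega>) / real (Suc m)) \<longlonglongrightarrow> h n \<omega>"
      unfolding q_def by real_asymp
    then have "(\<lambda>m. (\<Sum>k<n. h k \<omega> *\<^sub>R c k) + (of_int (q m \<omega>) / real (Suc m)) *\<^sub>R c n)
        \<longlonglongrightarrow> (\<Sum>k<Suc n. h k \<omega> *\<^sub>R c k)"
      unfolding sum.lessThan_Suc by (intro tendsto_intros)
    then show "(\<lambda>m. G' m (q m \<omega>) (\<Sum>k<n. h k \<omega> *\<^sub>R c k)) \<longlonglongrightarrow> G (\<Sum>k<Suc n. h k \<omega> *\<^sub>R c k)"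
      unfolding G'_def using Suc.prems(2)
      by (intro continuous_on_tendsto_compose[OF Suc.prems(2)]) auto
  qed
qed simp

text \<open>The finite-dimensional Hahn--Banach theorem: the induction step separates the slopes to the
  left from the slopes to the right.\<close>

lemma convex_subgradient_combination:
  fixes G :: "'a::real_vector \<Rightarrow> real"
  assumes "convex_on UNIV G"
  obtains l :: "nat \<Rightarrow> real" where
    "\<And>w. G p + (\<Sum>k<n. w k * l k) \<le> G (p + (\<Sum>k<n. w k *\<^sub>R c k))"
proof (induction n arbitrary: thesis)
  case (Suc n)
  have convex: "G (u *\<^sub>R x + v *\<^sub>R y) \<le> u * G x + v * G y" if "0 \<le> u" "0 \<le> v" "u + v = 1" for u v x y
    using assms that unfolding convex_on_def by blast
  obtain l where l: "\<And>w. G p + (\<Sum>k<n. w k * l k) \<le> G (p + (\<Sum>k<n. w k *\<^sub>R c k))"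
    using Suc.IH by blast
  define L where "L w = (\<Sum>k<n. w k * l k)" for w
  define V where "V w = (\<Sum>k<n. w k *\<^sub>R c k)" for w
  define left where "left s w = (G p + L w - G (p + V w - s *\<^sub>R c n)) / s" for s w
  define right where "right t w = (G (p + V w + t *\<^sub>R c n) - G p - L w) / t" for t w
  have sep: "left s w \<le> right t v" if "s > 0" "t > 0" for s t v w
  proof -
    \<comment> \<open>The weights are chosen so that the multiples \<open>t\<close> and
      \<open>- s\<close> of \<open>c n\<close> cancel: \<open>p + V u\<close> becomes a convex
      combination of the two points at which the slopes are taken.\<close>
    define u where "u k = (s / (s + t)) * v k + (t / (s + t)) * w k" for k
    have conv: "p + V u = (s / (s + t)) *\<^sub>R (p + V v + t *\<^sub>R c n) + (t / (s + t)) *\<^sub>R (p + V w - s *\<^sub>R c n)"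
    proof -
      have "V u = (s / (s + t)) *\<^sub>R V v + (t / (s + t)) *\<^sub>R V w"
        unfolding V_def u_def by (simp add: sum.distrib scaleR_sum_right scaleR_add_left)
      moreover have "p = (s / (s + t)) *\<^sub>R p + (t / (s + t)) *\<^sub>R p"
        using that by (simp flip: scaleR_add_left add_divide_distrib)
      ultimately show ?thesis by (simp add: algebra_simps)
    qed
    have Lu: "L u = (s / (s + t)) * L v + (t / (s + t)) * L w"
      unfolding L_def u_def by (simp add: sum.distrib sum_distrib_left algebra_simps)
    have "G p + L u \<le> G (p + V u)"
      using l[of u] unfolding L_def V_def .
    also have "\<dots> \<le> (s / (s + t)) * G (p + V v + t *\<^sub>R c n) + (t / (s + t)) * G (p + V w - s *\<^sub>R c n)"
      unfolding conv using that by (intro convex) (auto simp flip: add_divide_distrib)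
    also have "\<dots> = (s * G (p + V v + t *\<^sub>R c n) + t * G (p + V w - s *\<^sub>R c n)) / (s + t)"
      by (simp add: add_divide_distrib)
    finally have "(s + t) * (G p + L u) \<le> s * G (p + V v + t *\<^sub>R c n) + t * G (p + V w - s *\<^sub>R c n)"
      using that by (simp add: pos_le_divide_eq mult.commute)
    moreover have "(s + t) * L u = s * L v + t * L w"
      unfolding Lu using that by (simp add: distrib_left)
    ultimately have "s * (G p + L v) + t * (G p + L w) \<le> s * G (p + V v + t *\<^sub>R c n) + t * G (p + V w - s *\<^sub>R c n)"
      by (simp add: algebra_simps)
    then show ?thesis
      unfolding left_def right_def using that by (simp add: field_simps)
  qed
  \<comment> \<open>The new coefficient of the subgradient must lie between all left and all right
    slopes; the supremum of the left slopes does, and any single right slope shows that it is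
    finite.\<close>
  define r where "r = (SUP (s, w)\<in>{0<..} \<times> UNIV. left s w)"
  have bdd: "bdd_above ((\<lambda>(s, w). left s w) ` ({0<..} \<times> UNIV))"
    by (rule bdd_aboveI2[where M = "right 1 undefined"]) (use sep[of _ 1] in auto)
  have r1: "left s w \<le> r" if "s > 0" for s w
    unfolding r_def using that by (intro cSUP_upper2[OF bdd, of "(s, w)"]) auto
  have r2: "r \<le> right t w" if "t > 0" for t w
    unfolding r_def by (rule cSUP_least) (use sep that in \<open>auto intro: exI[of _ 1]\<close>)
  have "G p + (\<Sum>k<Suc n. w k * (l(n := r)) k) \<le> G (p + (\<Sum>k<Suc n. w k *\<^sub>R c k))" for w
  proof -
    have L: "(\<Sum>k<Suc n. w k * (l(n := r)) k) = L w + w n * r"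
      unfolding L_def by simp
    have "G p + L w + w n * r \<le> G (p + V w + w n *\<^sub>R c n)"
    proof (cases "w n" "0::real" rule: linorder_cases)
      case less
      have "left (- w n) w \<le> r" using less by (intro r1) simp
      then show ?thesis using less unfolding left_def by (simp add: field_simps)
    next
      case equal
      then show ?thesis using l[of w] unfolding L_def V_def by simp
    next
      case greater
      have "r \<le> right (w n) w" using greater by (intro r2)
      then show ?thesis using greater unfolding right_def by (simp add: field_simps)
    qed
    then show ?thesis unfolding L V_def by (simp add: add.assoc)
  qed
  then show ?case by (rule Suc.prems)
qed simp

text \<open>If the right-hand side is finite, a subgradient of \<open>G\<close> at the mean, taken
  only along the vectors \<open>c k\<close>, can be integrated: its linear term has expectation
  zero. Only the scalar coefficients are integrated, never a vector-valued function.\<close>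

lemma (in prob_space) jensens_inequality_combination:
  fixes G :: "'c::real_normed_vector \<Rightarrow> real" and h :: "nat \<Rightarrow> 'a \<Rightarrow> real"
  assumes "convex_on UNIV G" "continuous_on UNIV G" and nonneg: "\<And>x. 0 \<le> G x"
    and h: "\<And>k. k < n \<Longrightarrow> integrable M (h k)"
  shows "ennreal (G (\<Sum>k<n. expectation (h k) *\<^sub>R c k)) \<le> (\<integral>\<^sup>+\<omega>. ennreal (G (\<Sum>k<n. h k \<omega> *\<^sub>R c k)) \<partial>M)"
proof (cases "(\<integral>\<^sup>+\<omega>. ennreal (G (\<Sum>k<n. h k \<omega> *\<^sub>R c k)) \<partial>M) < \<infinity>")
  case True
  define p where "p = (\<Sum>k<n. expectation (h k) *\<^sub>R c k)"
  obtain l where l: "\<And>w. G p + (\<Sum>k<n. w k * l k) \<le> G (p + (\<Sum>k<n. w k *\<^sub>R c k))"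
    using convex_subgradient_combination[OF assms(1)] by blast
  have meas: "(\<lambda>\<omega>. G (\<Sum>k<n. h k \<omega> *\<^sub>R c k)) \<in> borel_measurable M"
    using h assms(2) by (intro borel_measurable_continuous_combination) auto
  have int: "integrable M (\<lambda>\<omega>. G (\<Sum>k<n. h k \<omega> *\<^sub>R c k))"
    using meas True nonneg by (intro integrableI_nonneg) auto
  have "G p = expectation (\<lambda>\<omega>. G p + (\<Sum>k<n. (h k \<omega> - expectation (h k)) * l k))"
    using h by (subst Bochner_Integration.integral_add) (auto simp: prob_space)
  also have "\<dots> \<le> expectation (\<lambda>\<omega>. G (\<Sum>k<n. h k \<omega> *\<^sub>R c k))"
  proof (rule integral_mono[OF _ int])
    show "integrable M (\<lambda>\<omega>. G p + (\<Sum>k<n. (h k \<omega> - expectation (h k)) * l k))"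
      by (intro Bochner_Integration.integrable_add Bochner_Integration.integrable_sum
          integrable_mult_left Bochner_Integration.integrable_diff) (use h in auto)
    fix \<omega>
    show "G p + (\<Sum>k<n. (h k \<omega> - expectation (h k)) * l k) \<le> G (\<Sum>k<n. h k \<omega> *\<^sub>R c k)"
      using l[of "\<lambda>k. h k \<omega> - expectation (h k)"] unfolding p_def
      by (simp add: scaleR_diff_left sum_subtractf)
  qed
  finally have "ennreal (G p) \<le> ennreal (expectation (\<lambda>\<omega>. G (\<Sum>k<n. h k \<omega> *\<^sub>R c k)))"
    by (rule ennreal_leI)
  then show ?thesis
    unfolding p_def using nn_integral_eq_integral[OF int] nonneg by simp
next
  case False
  then show ?thesis by (simp add: less_top[symmetric])
qed

subsection \<open>The kernel as an average over directions\<close>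

lemma nn_integral_lborel_affine:
  fixes t :: "'b::euclidean_space"
  assumes "F \<in> borel_measurable borel" "c \<noteq> 0"
  shows "(\<integral>\<^sup>+y. F y \<partial>lborel) = ennreal (\<bar>c\<bar> ^ DIM('b)) * (\<integral>\<^sup>+v. F (t + c *\<^sub>R v) \<partial>lborel)"
proof -
  have "(\<integral>\<^sup>+y. F y \<partial>lborel)
      = (\<integral>\<^sup>+y. F y \<partial>density (distr lborel borel (\<lambda>v. t + c *\<^sub>R v)) (\<lambda>_. ennreal (\<bar>c\<bar> ^ DIM('b))))"
    using lborel_affine[OF assms(2), of t] by simp
  also have "\<dots> = ennreal (\<bar>c\<bar> ^ DIM('b)) * (\<integral>\<^sup>+v. F (t + c *\<^sub>R v) \<partial>lborel)"
    using assms(1) by (simp add: nn_integral_density nn_integral_distr nn_integral_cmult)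
  finally show ?thesis .
qed

text \<open>The substitution \<open>u = (a / s)^2\<close> turns the integral into the Gamma integral
  at \<open>(n + 1) / 2\<close>, up to the factor \<open>1 / (2 * a ^ (n + 1))\<close>.\<close>

lemma nn_integral_inverse_power_gaussian:
  fixes a :: real
  assumes "a > 0"
  shows "(\<integral>\<^sup>+s. ennreal (indicator {0<..} s * ((1 / s) ^ (n + 2) * exp (- (a / s)\<^sup>2))) \<partial>lborel)
    = ennreal (Gamma ((real n + 1) / 2) / (2 * a ^ (n + 1)))"
proof -
  define f where "f s = (1 / s) ^ (n + 2) * exp (- (a / s)\<^sup>2)" for s :: real
  \<comment> \<open>\<open>s = g u\<close> solves \<open>u = (a / s)^2\<close> for \<open>s\<close>;
    its derivative \<open>g'\<close> is negative for \<open>u > 0\<close>, whence the absolute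
    values below.\<close>
  define g where "g u = a * u powr (- 1 / 2)" for u
  define g' where "g' u = a * (- 1 / 2) * u powr (- 3 / 2)" for u
  define I where "I = Gamma ((real n + 1) / 2) / (2 * a ^ (n + 1))"
  have gu: "\<bar>g' u\<bar> * f (g u) = 1 / (2 * a ^ (n + 1)) * (u powr ((real n + 1) / 2 - 1) / exp u)" if "u > 0" for u
  proof -
    have inv: "1 / g u = u powr (1 / 2) / a"
      unfolding g_def using that assms by (simp add: powr_minus field_simps)
    have "(a / g u)\<^sup>2 = (u powr (1 / 2))\<^sup>2"
      unfolding g_def using that assms by (simp add: powr_minus field_simps)
    also have "\<dots> = u"
      using that by (simp flip: powr_realpow powr_add add: power2_eq_square)
    finally have sq: "(a / g u)\<^sup>2 = u" .
    have "(u powr (1 / 2)) ^ (n + 2) = (u powr (1 / 2)) powr real (n + 2)"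
      using that by (subst powr_realpow) auto
    then have "(u powr (1 / 2)) ^ (n + 2) = u powr ((real n + 2) / 2)"
      by (simp add: powr_powr add.commute)
    moreover have "- 3 / 2 + (real n + 2) / 2 = (real n + 1) / 2 - 1"
      by (simp add: field_simps)
    ultimately have "u powr (- 3 / 2) * (u powr (1 / 2)) ^ (n + 2) = u powr ((real n + 1) / 2 - 1)"
      by (metis powr_add)
    moreover have "\<bar>g' u\<bar> = a / 2 * u powr (- 3 / 2)"
      unfolding g'_def using assms by (simp add: abs_mult)
    moreover have "\<bar>g' u\<bar> * f (g u) = \<bar>g' u\<bar> * (u powr (1 / 2)) ^ (n + 2) / a ^ (n + 2) / exp u"
      unfolding f_def inv sq by (simp add: power_divide exp_minus field_simps del: power_Suc power_Suc2 add_2_eq_Suc')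
    ultimately have "\<bar>g' u\<bar> * f (g u) = a / 2 * u powr ((real n + 1) / 2 - 1) / a ^ (n + 2) / exp u"
      by (metis mult.assoc)
    then show ?thesis
      using assms by (simp add: field_simps)
  qed
  have "((\<lambda>u. u powr ((real n + 1) / 2 - 1) / exp u) has_integral Gamma ((real n + 1) / 2)) {0<..}
      \<longleftrightarrow> ((\<lambda>u. u powr ((real n + 1) / 2 - 1) / exp u) has_integral Gamma ((real n + 1) / 2)) {0..}"
    by (rule has_integral_spike_set_eq; rule negligible_subset[of "{0}"]) auto
  then have Gamma: "((\<lambda>u. u powr ((real n + 1) / 2 - 1) / exp u) has_integral Gamma ((real n + 1) / 2)) {0<..}"
    using Gamma_integral_real[of "(real n + 1) / 2"] by simp
  have "((\<lambda>u. 1 / (2 * a ^ (n + 1)) * (u powr ((real n + 1) / 2 - 1) / exp u)) has_integral I) {0<..}"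
    using has_integral_mult_right[OF Gamma, of "1 / (2 * a ^ (n + 1))"] unfolding I_def by simp
  then have hi: "((\<lambda>u. \<bar>g' u\<bar> * f (g u)) has_integral I) {0<..}"
    by (rule has_integral_eq[rotated]) (use gu in auto)
  have "(\<lambda>u. \<bar>g' u\<bar> * f (g u)) absolutely_integrable_on {0<..}"
    using hi assms by (intro nonnegative_absolutely_integrable_1) (auto simp: gu)
  moreover have "(g has_field_derivative g' u) (at u within {0<..})" if "u \<in> {0<..}" for u
    unfolding g_def g'_def using that by (auto intro!: derivative_eq_intros)
  moreover have "inj_on g {0<..}"
    unfolding g_def using assms by (auto simp: inj_on_def powr_minus powr_half_sqrt)
  moreover have "g ` {0<..} = {0<..}"
  proof
    show "g ` {0<..} \<subseteq> {0<..}" unfolding g_def using assms by auto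
    show "{0<..} \<subseteq> g ` {0<..}"
    proof
      fix s :: real assume s: "s \<in> {0<..}"
      have "s = g ((s / a) powr (-2))"
        unfolding g_def using s assms by (simp add: powr_powr)
      then show "s \<in> g ` {0<..}" using s assms by (auto intro!: image_eqI[where f = g])
    qed
  qed
  ultimately have "f absolutely_integrable_on {0<..} \<and> integral {0<..} f = I"
    using has_absolute_integral_change_of_variables_1'[of "{0<..}" g g' f I] hi
    by (auto dest: integral_unique)
  then have "(f has_integral I) {0<..}"
    using absolutely_integrable_on_def has_integral_integral by blast
  then have "(\<integral>\<^sup>+s. ennreal (indicator {0<..} s * f s) \<partial>lborel) = ennreal I"
    by (rule nn_integral_has_integral_lebesgue[rotated]) (auto simp: f_def)
  then show ?thesis unfolding f_def I_def .
qed

text \<open>The linear factor supplies the numerator of the kernel and removes the directions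
  pointing out of the half-space; the Gaussian factor makes the radial integrals Gamma
  integrals.\<close>

definition rotation_density :: "'d::finite \<Rightarrow> real ^ 'd \<Rightarrow> real" where
  "rotation_density j v =
     2 / pi powr ((real CARD('d) - 1) / 2) * (max 0 (v $ j) * exp (- (norm v)\<^sup>2))"

lemma rotation_density_nonneg: "0 \<le> rotation_density j v"
  unfolding rotation_density_def by simp

lemma rotation_density_measurable [measurable]: "rotation_density j \<in> borel_measurable borel"
  unfolding rotation_density_def by measurable

text \<open>The density is a product over the coordinates. Coordinate \<open>j\<close> contributes
  \<open>1 / 2\<close>, the integral of \<open>t * exp (- t^2)\<close> over the positive half-line,
  and each other coordinate contributes \<open>sqrt pi\<close>; the constant is the reciprocal of
  the product.\<close>

lemma nn_integral_rotation_density: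
  "(\<integral>\<^sup>+v. ennreal (rotation_density (j::'d::finite) v) \<partial>lborel) = 1"
proof -
  define \<phi> :: "real ^ 'd \<Rightarrow> real \<Rightarrow> real" where
    "\<phi> b t = (if b = axis j 1 then max 0 t else 1) * exp (- t\<^sup>2)" for b t
  define C where "C = 2 / pi powr ((real CARD('d) - 1) / 2)"
  have C: "C \<ge> 0" unfolding C_def by simp
  have j: "axis j 1 \<in> (Basis :: (real ^ 'd) set)" by simp
  have full: "(\<integral>\<^sup>+t. ennreal (exp (- t\<^sup>2)) \<partial>lborel) = ennreal (sqrt pi)"
    using has_bochner_integral_even_function[OF gaussian_moment_0]
    by (subst nn_integral_eq_integral) (auto dest: has_bochner_integral_integral_eq simp: has_bochner_integral_iff)
  have "(\<integral>\<^sup>+t. ennreal (max 0 t * exp (- t\<^sup>2)) \<partial>lborel)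
      = (\<integral>\<^sup>+t. ennreal (indicator {0..} t *\<^sub>R (exp (- t\<^sup>2) * t)) \<partial>lborel)"
    by (intro nn_integral_cong) (auto simp: max_def split: split_indicator)
  also have "\<dots> = ennreal (1 / 2)"
    unfolding has_bochner_integral_integral_eq[OF gaussian_moment_1, symmetric]
    by (rule nn_integral_eq_integral[OF integrable.intros[OF gaussian_moment_1]])
      (auto split: split_indicator)
  finally have half: "(\<integral>\<^sup>+t. ennreal (max 0 t * exp (- t\<^sup>2)) \<partial>lborel) = ennreal (1 / 2)" .
  have "rotation_density j v = C * (\<Prod>b\<in>Basis. \<phi> b (v \<bullet> b))" for v :: "real ^ 'd"
  proof -
    have "(\<Prod>b\<in>Basis. \<phi> b (v \<bullet> b))
        = (\<Prod>b\<in>Basis. if b = axis j 1 then max 0 (v \<bullet> b) else 1) * exp (- (\<Sum>b\<in>Basis. (v \<bullet> b)\<^sup>2))"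
      unfolding \<phi>_def by (simp add: prod.distrib exp_sum sum_negf[symmetric])
    also have "(\<Prod>b\<in>Basis. if b = axis j 1 then max 0 (v \<bullet> b) else 1) = max 0 (v $ j)"
      using j by (simp add: prod.delta' prod.delta cart_eq_inner_axis)
    also have "(\<Sum>b\<in>Basis. (v \<bullet> b)\<^sup>2) = (norm v)\<^sup>2"
      unfolding power2_norm_eq_inner by (subst euclidean_inner[of v v]) (simp add: power2_eq_square)
    finally show ?thesis unfolding rotation_density_def C_def by simp
  qed
  moreover have "ennreal (\<Prod>b\<in>Basis. \<phi> b (v \<bullet> b)) = (\<Prod>b\<in>Basis. ennreal (\<phi> b (v \<bullet> b)))" for v
    by (rule prod_ennreal[symmetric]) (simp add: \<phi>_def)
  ultimately have "ennreal (rotation_density j v) = ennreal C * (\<Prod>b\<in>Basis. ennreal (\<phi> b (v \<bullet> b)))" for v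
    using C by (metis ennreal_mult')
  then have "(\<integral>\<^sup>+v. ennreal (rotation_density j v) \<partial>lborel)
      = ennreal C * (\<integral>\<^sup>+v. (\<Prod>b\<in>Basis. ennreal (\<phi> b (v \<bullet> b))) \<partial>(lborel :: (real ^ 'd) measure))"
    by (simp only:) (rule nn_integral_cmult, simp add: \<phi>_def)
  also have "(\<integral>\<^sup>+v. (\<Prod>b\<in>Basis. ennreal (\<phi> b (v \<bullet> b))) \<partial>(lborel :: (real ^ 'd) measure))
      = (\<Prod>b\<in>Basis. \<integral>\<^sup>+t. ennreal (\<phi> b t) \<partial>lborel)"
    by (rule nn_integral_lborel_prod) (auto simp: \<phi>_def)
  also have "\<dots> = (\<Prod>b\<in>(Basis :: (real ^ 'd) set). ennreal (if b = axis j 1 then 1 / 2 else sqrt pi))"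
    by (intro prod.cong) (auto simp: \<phi>_def full half)
  also have "\<dots> = ennreal (\<Prod>b\<in>(Basis :: (real ^ 'd) set). if b = axis j 1 then 1 / 2 else sqrt pi)"
    by (rule prod_ennreal) auto
  also have "(\<Prod>b\<in>(Basis :: (real ^ 'd) set). if b = axis j 1 then 1 / 2 else sqrt pi)
      = 1 / 2 * sqrt pi ^ (CARD('d) - 1)"
    using j by (subst prod.remove[OF _ j]) (auto simp: card_Diff_singleton intro!: prod.cong)
  also have "sqrt pi ^ (CARD('d) - 1) = pi powr ((real CARD('d) - 1) / 2)"
    by (simp add: powr_half_sqrt[symmetric] powr_realpow[symmetric] powr_powr of_nat_diff Suc_leI)
  finally show ?thesis unfolding C_def by (simp flip: ennreal_mult)
qed

text \<open>The kernel of the \<open>j\<close>-th Riesz transform. \<open>T_op\<close> uses it at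
  \<open>x + y\<close>, which stays away from the singularity at the origin when both points lie in
  the half-space.\<close>

definition T_kernel :: "'d::finite \<Rightarrow> real ^ 'd \<Rightarrow> real" where
  "T_kernel j z = Gamma ((real CARD('d) + 1) / 2) / pi powr ((real CARD('d) + 1) / 2)
     * (z $ j / norm z ^ (CARD('d) + 1))"

text \<open>At \<open>z / s\<close> the linear factor of the density yields one more
  \<open>1 / s\<close>, so the Gaussian integral is needed with the exponent
  \<open>CARD('d) + 2\<close> and gives a multiple of
  \<open>z $ j / norm z ^ (CARD('d) + 1)\<close>.\<close>

lemma nn_integral_rotation_density_radial:
  fixes z :: "real ^ 'd::finite"
  assumes "z $ j > 0"
  shows "(\<integral>\<^sup>+s. ennreal (indicator {0<..} s * ((1 / s) ^ (CARD('d) + 1) * rotation_density j ((1 / s) *\<^sub>R z))) \<partial>lborel)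
    = ennreal (pi * T_kernel j z)"
proof -
  define C where "C = 2 / pi powr ((real CARD('d) - 1) / 2) * z $ j"
  have z: "norm z > 0" using assms by auto
  have C: "C \<ge> 0" unfolding C_def using assms by simp
  have "(\<integral>\<^sup>+s. ennreal (indicator {0<..} s * ((1 / s) ^ (CARD('d) + 1) * rotation_density j ((1 / s) *\<^sub>R z))) \<partial>lborel)
     = (\<integral>\<^sup>+s. ennreal C * ennreal (indicator {0<..} s * ((1 / s) ^ (CARD('d) + 2) * exp (- (norm z / s)\<^sup>2))) \<partial>lborel)"
    using C assms unfolding C_def rotation_density_def
    by (intro nn_integral_cong)
      (auto simp flip: ennreal_mult simp: power_divide max_def mult_ac split: split_indicator)
  also have "\<dots> = ennreal C * ennreal (Gamma ((real CARD('d) + 1) / 2) / (2 * norm z ^ (CARD('d) + 1)))"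
    unfolding nn_integral_inverse_power_gaussian[OF z, symmetric] by (rule nn_integral_cmult) measurable
  also have "\<dots> = ennreal (C * (Gamma ((real CARD('d) + 1) / 2) / (2 * norm z ^ (CARD('d) + 1))))"
    using C by (rule ennreal_mult'[symmetric])
  also have "C * (Gamma ((real CARD('d) + 1) / 2) / (2 * norm z ^ (CARD('d) + 1))) = pi * T_kernel j z"
  proof -
    have "pi powr ((real CARD('d) + 1) / 2) = pi * pi powr ((real CARD('d) - 1) / 2)"
      by (simp add: powr_mult_base add_divide_distrib diff_divide_distrib add.commute)
    then show ?thesis unfolding C_def T_kernel_def by (simp add: field_simps)
  qed
  finally show ?thesis .
qed

text \<open>For \<open>s \<le> 0\<close> the coercion \<open>ennreal (1 / s)\<close> is \<open>0\<close>, so that only the ray \<open>s > 0\<close> counts.\<close>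

definition ray_integral :: "'b::euclidean_space set \<Rightarrow> 'b \<Rightarrow> 'b \<Rightarrow> ennreal" where
  "ray_integral S q v = (\<integral>\<^sup>+s. ennreal (1 / s) * indicator S (q + s *\<^sub>R v) \<partial>lborel)"

lemma ray_integral_measurable [measurable]:
  fixes S :: "'b::euclidean_space set"
  assumes [measurable]: "S \<in> sets borel"
  shows "case_prod (ray_integral S) \<in> borel_measurable (borel \<Otimes>\<^sub>M borel)"
  unfolding ray_integral_def by measurable

text \<open>Tonelli's theorem allows the substitution \<open>y = - x + s v\<close> for fixed
  \<open>s > 0\<close>. Its Jacobian contributes \<open>(1 / s) ^ CARD('d)\<close> besides the
  factor \<open>1 / s\<close> of the ray integral, and the remaining integral over \<open>s\<close>
  is the radial one at \<open>z = x + y\<close>.\<close>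

lemma rotation_average:
  fixes x :: "real ^ 'd::finite"
  assumes [measurable]: "S \<in> sets borel" and S: "S \<subseteq> pos_halfspace j" and x: "x \<in> pos_halfspace j"
  shows "(\<integral>\<^sup>+v. ennreal (rotation_density j v) * ray_integral S (- x) v \<partial>lborel)
    = (\<integral>\<^sup>+y. ennreal (pi * T_kernel j (x + y)) * indicator S y \<partial>lborel)"
proof -
  let ?D = "CARD('d)"
  have "(\<integral>\<^sup>+v. ennreal (rotation_density j v) * ray_integral S (- x) v \<partial>lborel)
      = (\<integral>\<^sup>+v. \<integral>\<^sup>+s. ennreal (rotation_density j v) * (ennreal (1 / s) * indicator S (- x + s *\<^sub>R v)) \<partial>lborel \<partial>lborel)"
    unfolding ray_integral_def by (subst nn_integral_cmult) simp_all
  also have "\<dots> = (\<integral>\<^sup>+s. \<integral>\<^sup>+v. ennreal (rotation_density j v) * (ennreal (1 / s) * indicator S (- x + s *\<^sub>R v)) \<partial>lborel \<partial>lborel)"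
    by (rule lborel_pair.Fubini') measurable
  also have "\<dots> = (\<integral>\<^sup>+s. \<integral>\<^sup>+y. ennreal (indicator {0<..} s * ((1 / s) ^ (?D + 1) * rotation_density j ((1 / s) *\<^sub>R (x + y)))) * indicator S y \<partial>lborel \<partial>lborel)"
  proof (rule nn_integral_cong)
    fix s :: real
    show "(\<integral>\<^sup>+v. ennreal (rotation_density j v) * (ennreal (1 / s) * indicator S (- x + s *\<^sub>R v)) \<partial>lborel)
      = (\<integral>\<^sup>+y. ennreal (indicator {0<..} s * ((1 / s) ^ (?D + 1) * rotation_density j ((1 / s) *\<^sub>R (x + y)))) * indicator S y \<partial>lborel)"
    proof (cases "s > 0")
      case True
      have "(\<integral>\<^sup>+y. ennreal (indicator {0<..} s * ((1 / s) ^ (?D + 1) * rotation_density j ((1 / s) *\<^sub>R (x + y)))) * indicator S y \<partial>lborel)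
        = ennreal (\<bar>s\<bar> ^ ?D) * (\<integral>\<^sup>+v. ennreal (indicator {0<..} s * ((1 / s) ^ (?D + 1) * rotation_density j ((1 / s) *\<^sub>R (x + (- x + s *\<^sub>R v))))) * indicator S (- x + s *\<^sub>R v) \<partial>lborel)"
        using True by (subst nn_integral_lborel_affine[where t = "- x" and c = s]) auto
      also have "\<dots> = (\<integral>\<^sup>+v. ennreal (\<bar>s\<bar> ^ ?D) * (ennreal (indicator {0<..} s * ((1 / s) ^ (?D + 1) * rotation_density j ((1 / s) *\<^sub>R (x + (- x + s *\<^sub>R v))))) * indicator S (- x + s *\<^sub>R v)) \<partial>lborel)"
        by (rule nn_integral_cmult[symmetric]) measurable
      also have "\<dots> = (\<integral>\<^sup>+v. ennreal (rotation_density j v) * (ennreal (1 / s) * indicator S (- x + s *\<^sub>R v)) \<partial>lborel)"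
        using True rotation_density_nonneg[of j]
        by (intro nn_integral_cong) (auto simp flip: ennreal_mult simp: power_divide split: split_indicator)
      finally show ?thesis by simp
    qed (simp add: ennreal_neg)
  qed
  also have "\<dots> = (\<integral>\<^sup>+y. \<integral>\<^sup>+s. ennreal (indicator {0<..} s * ((1 / s) ^ (?D + 1) * rotation_density j ((1 / s) *\<^sub>R (x + y)))) * indicator S y \<partial>lborel \<partial>lborel)"
    by (rule lborel_pair.Fubini') measurable
  also have "\<dots> = (\<integral>\<^sup>+y. ennreal (pi * T_kernel j (x + y)) * indicator S y \<partial>lborel)"
  proof (rule nn_integral_cong)
    fix y
    show "(\<integral>\<^sup>+s. ennreal (indicator {0<..} s * ((1 / s) ^ (?D + 1) * rotation_density j ((1 / s) *\<^sub>R (x + y)))) * indicator S y \<partial>lborel)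
      = ennreal (pi * T_kernel j (x + y)) * indicator S y"
    proof (cases "y \<in> S")
      case True
      then have "(x + y) $ j > 0" using S x unfolding pos_halfspace_def by (auto intro: add_pos_pos)
      from nn_integral_rotation_density_radial[OF this] show ?thesis using True by simp
    qed simp
  qed
  finally show ?thesis .
qed

subsection \<open>Directional Hilbert transforms\<close>

text \<open>The slab replaces a transversal hyperplane, so that no change of coordinates is needed.
  For every point \<open>q\<close>, the parameters \<open>t\<close> with \<open>q - t v\<close> in
  the slab form a half-open interval of length 1; hence averaging over the lines that start in the
  slab counts each point exactly once.\<close>

lemma nn_integral_lines:
  fixes v :: "real ^ 'd::finite"
  assumes F [measurable]: "F \<in> borel_measurable borel" and v: "v $ j > 0"
  shows "(\<integral>\<^sup>+q. F q \<partial>lborel)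
    = (\<integral>\<^sup>+q. indicator {q. 0 \<le> q $ j \<and> q $ j < v $ j} q * (\<integral>\<^sup>+t. F (q + t *\<^sub>R v) \<partial>lborel) \<partial>lborel)"
proof -
  define Q where "Q = {q. 0 \<le> q $ j \<and> q $ j < v $ j}"
  have [measurable]: "Q \<in> sets borel" unfolding Q_def by measurable
  have "(\<integral>\<^sup>+q. indicator Q q * (\<integral>\<^sup>+t. F (q + t *\<^sub>R v) \<partial>lborel) \<partial>lborel)
      = (\<integral>\<^sup>+q. \<integral>\<^sup>+t. indicator Q q * F (q + t *\<^sub>R v) \<partial>lborel \<partial>lborel)"
    by (subst nn_integral_cmult) simp_all
  also have "\<dots> = (\<integral>\<^sup>+t. \<integral>\<^sup>+q. indicator Q q * F (q + t *\<^sub>R v) \<partial>lborel \<partial>lborel)"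
    by (rule lborel_pair.Fubini') measurable
  also have "\<dots> = (\<integral>\<^sup>+t. \<integral>\<^sup>+q. indicator Q (q - t *\<^sub>R v) * F q \<partial>lborel \<partial>lborel)"
  proof (rule nn_integral_cong)
    fix t :: real
    show "(\<integral>\<^sup>+q. indicator Q q * F (q + t *\<^sub>R v) \<partial>lborel) = (\<integral>\<^sup>+q. indicator Q (q - t *\<^sub>R v) * F q \<partial>lborel)"
      by (subst (2) nn_integral_lborel_affine[where t = "t *\<^sub>R v" and c = 1]) (auto simp: add.commute)
  qed
  also have "\<dots> = (\<integral>\<^sup>+q. \<integral>\<^sup>+t. indicator Q (q - t *\<^sub>R v) * F q \<partial>lborel \<partial>lborel)"
    by (rule lborel_pair.Fubini') measurable
  also have "\<dots> = (\<integral>\<^sup>+q. F q \<partial>lborel)"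
  proof (rule nn_integral_cong)
    fix q
    have "(\<integral>\<^sup>+t. indicator Q (q - t *\<^sub>R v) * F q \<partial>lborel)
        = (\<integral>\<^sup>+t. F q * indicator {q $ j / v $ j - 1<..q $ j / v $ j} t \<partial>lborel)"
      using v unfolding Q_def by (intro nn_integral_cong) (auto simp: field_simps split: split_indicator)
    also have "\<dots> = F q"
      by (subst nn_integral_cmult_indicator) auto
    finally show "(\<integral>\<^sup>+t. indicator Q (q - t *\<^sub>R v) * F q \<partial>lborel) = F q" .
  qed
  finally show ?thesis unfolding Q_def by simp
qed

text \<open>A ray that starts strictly below the hyperplane meets the bounded set \<open>S\<close>
  only for parameters in a compact interval away from 0, where \<open>1 / s\<close> is bounded. If
  \<open>v $ j\<close> is not positive, the ray misses \<open>S\<close> altogether.\<close>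

lemma ray_integral_finite:
  fixes S :: "(real ^ 'd::finite) set"
  assumes "bounded S" "S \<subseteq> pos_halfspace j" "p $ j < 0"
  shows "ray_integral S p v < \<infinity>"
proof (cases "v $ j > 0")
  case True
  obtain B where B: "\<And>x. x \<in> S \<Longrightarrow> norm x \<le> B"
    using assms(1) unfolding bounded_iff by blast
  \<comment> \<open>\<open>M\<close> bounds the parameters from above through the norm bound on
    \<open>S\<close>; \<open>\<delta>\<close> is the parameter at which the ray crosses the
    hyperplane.\<close>
  define M where "M = (B - p $ j) / v $ j"
  define \<delta> where "\<delta> = - p $ j / v $ j"
  have \<delta>: "\<delta> > 0" unfolding \<delta>_def using True assms(3) by (simp add: field_simps)
  have range: "s \<ge> \<delta> \<and> s \<le> M" if "p + s *\<^sub>R v \<in> S" for s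
  proof -
    have "p $ j + s * v $ j > 0" using that assms(2) unfolding pos_halfspace_def by auto
    moreover have "p $ j + s * v $ j \<le> B"
      using B[OF that] component_le_norm_cart[of "p + s *\<^sub>R v" j] by simp
    ultimately show ?thesis using True unfolding \<delta>_def M_def by (simp add: field_simps)
  qed
  have "ennreal (1 / s) * indicator S (p + s *\<^sub>R v) \<le> ennreal (1 / \<delta>) * indicator {\<delta>..M} s" for s
    using range[of s] \<delta> by (auto split: split_indicator intro!: ennreal_leI frac_le)
  then have "ray_integral S p v \<le> (\<integral>\<^sup>+s. ennreal (1 / \<delta>) * indicator {\<delta>..M} s \<partial>lborel)"
    unfolding ray_integral_def by (intro nn_integral_mono)
  also have "\<dots> < \<infinity>"
    by (subst nn_integral_cmult_indicator)
      (simp_all add: ennreal_mult_less_top emeasure_lborel_Icc_eq)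
  finally show ?thesis .
next
  case False
  have out: "p + s *\<^sub>R v \<notin> S" if "s > 0" for s
    using assms(2,3) False that mult_nonneg_nonpos[of s "v $ j"] unfolding pos_halfspace_def by fastforce
  have "ennreal (1 / s) * indicator S (p + s *\<^sub>R v) = 0" for s
    using out[of s] by (cases "s > 0") (auto simp: ennreal_neg)
  then show ?thesis unfolding ray_integral_def by (simp only:) simp
qed

text \<open>For \<open>S\<close> bounded in the half-space, \<open>q $ j < 0\<close> and
  \<open>v $ j > 0\<close>, this is minus the Hilbert transform of the indicator of \<open>S\<close>
  along the line through \<open>q\<close>, at the point \<open>q\<close>. The ray integral is finite
  there, so \<open>enn2real\<close> loses nothing, and a real value can serve as a scalar
  coefficient.\<close>

definition ray_hilbert :: "(real ^ 'd::finite) set \<Rightarrow> real ^ 'd \<Rightarrow> real ^ 'd \<Rightarrow> real" where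
  "ray_hilbert S q v = enn2real (ray_integral S q v) / pi"

lemma ray_hilbert_measurable [measurable]:
  fixes S :: "(real ^ 'd::finite) set"
  assumes [measurable]: "S \<in> sets borel"
  shows "case_prod (ray_hilbert S) \<in> borel_measurable (borel \<Otimes>\<^sub>M borel)"
  unfolding ray_hilbert_def by measurable

text \<open>The point at parameter \<open>t\<close> lies below the hyperplane and \<open>S\<close>
  above it, so only parameters \<open>s > t\<close> contribute and the integrand is nonnegative.
  Shifting \<open>s\<close> by \<open>t\<close> gives the ray integral.\<close>

lemma hilbert_kernel_has_integral:
  fixes S :: "(real ^ 'd::finite) set"
  assumes [measurable]: "S \<in> sets borel" and S: "bounded S" "S \<subseteq> pos_halfspace j"
    and p: "(q + t *\<^sub>R v) $ j < 0" and v: "v $ j > 0"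
  shows "((\<lambda>s. indicator S (q + s *\<^sub>R v) / (s - t)) has_integral pi * ray_hilbert S (q + t *\<^sub>R v) v) UNIV"
proof (rule nn_integral_has_integral)
  show "(\<lambda>s. indicator S (q + s *\<^sub>R v) / (s - t)) \<in> borel_measurable borel" by measurable
  show "0 \<le> indicator S (q + s *\<^sub>R v) / (s - t)" for s
  proof (cases "q + s *\<^sub>R v \<in> S")
    case True
    then have "q $ j + s * v $ j > 0" using S(2) unfolding pos_halfspace_def by auto
    then have "t * v $ j < s * v $ j" using p by simp
    then show ?thesis using v by simp
  qed simp
  show "0 \<le> pi * ray_hilbert S (q + t *\<^sub>R v) v" unfolding ray_hilbert_def by simp
  have "(\<integral>\<^sup>+s. ennreal (indicator S (q + s *\<^sub>R v) / (s - t)) \<partial>lborel) = ray_integral S (q + t *\<^sub>R v) v"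
    unfolding ray_integral_def
    by (subst nn_integral_lborel_affine[where t = t and c = 1])
      (auto intro!: nn_integral_cong simp: algebra_simps split: split_indicator)
  also have "\<dots> = ennreal (pi * ray_hilbert S (q + t *\<^sub>R v) v)"
    using ray_integral_finite[OF S p, of v] unfolding ray_hilbert_def by (simp add: less_top)
  finally show "(\<integral>\<^sup>+s. ennreal (indicator S (q + s *\<^sub>R v) / (s - t)) \<partial>lborel)
      = ennreal (pi * ray_hilbert S (q + t *\<^sub>R v) v)" .
qed

text \<open>At parameter \<open>t\<close> the line is still at a positive distance
  \<open>\<delta>\<close> from the support. Truncation at \<open>\<epsilon> < \<delta>\<close>
  therefore removes nothing, and the limit is that of an eventually constant function. The sign
  comes from \<open>t - s\<close> against \<open>s - t\<close>.\<close>

lemma hilbert_transform_line: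
  fixes S :: "nat \<Rightarrow> (real ^ 'd::finite) set" and c :: "nat \<Rightarrow> 'a::banach"
  assumes S: "\<And>k. k < n \<Longrightarrow> S k \<in> sets borel" "\<And>k. k < n \<Longrightarrow> bounded (S k)" "\<And>k. k < n \<Longrightarrow> S k \<subseteq> pos_halfspace j"
    and p: "(q + t *\<^sub>R v) $ j < 0" and v: "v $ j > 0"
  shows "hilbert_transform (\<lambda>s. \<Sum>k<n. indicator (S k) (q + s *\<^sub>R v) *\<^sub>R c k) t
    = - (\<Sum>k<n. ray_hilbert (S k) (q + t *\<^sub>R v) v *\<^sub>R c k)"
proof -
  define f where "f s = (\<Sum>k<n. indicator (S k) (q + s *\<^sub>R v) *\<^sub>R c k)" for s
  define I where "I = - (\<Sum>k<n. (pi * ray_hilbert (S k) (q + t *\<^sub>R v) v) *\<^sub>R c k)"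
  define \<delta> where "\<delta> = - (q + t *\<^sub>R v) $ j / v $ j"
  have \<delta>: "\<delta> > 0" unfolding \<delta>_def using p v by (simp add: field_simps)
  have far: "s - t \<ge> \<delta>" if "q + s *\<^sub>R v \<in> S k" "k < n" for s k
  proof -
    have "q $ j + s * v $ j > 0" using that S(3)[OF that(2)] unfolding pos_halfspace_def by auto
    then show ?thesis using v unfolding \<delta>_def by (simp add: field_simps)
  qed
  have int: "integral {s. \<bar>t - s\<bar> > \<epsilon>} (\<lambda>s. (1 / (t - s)) *\<^sub>R f s) = I" if "\<epsilon> < \<delta>" "\<epsilon> > 0" for \<epsilon>
  proof -
    have "((\<lambda>s. - (\<Sum>k<n. (indicator (S k) (q + s *\<^sub>R v) / (s - t)) *\<^sub>R c k)) has_integral I) UNIV"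
      unfolding I_def using S p v
      by (intro has_integral_neg has_integral_sum has_integral_scaleR_left hilbert_kernel_has_integral) auto
    moreover have "- (\<Sum>k<n. (indicator (S k) (q + s *\<^sub>R v) / (s - t)) *\<^sub>R c k)
        = (if s \<in> {s. \<bar>t - s\<bar> > \<epsilon>} then (1 / (t - s)) *\<^sub>R f s else 0)" for s
    proof (cases "\<bar>t - s\<bar> > \<epsilon>")
      case True
      have "1 / (t - s) = - (1 / (s - t))" by (metis minus_diff_eq divide_minus_right)
      then have "- (\<Sum>k<n. (indicator (S k) (q + s *\<^sub>R v) / (s - t)) *\<^sub>R c k) = (1 / (t - s)) *\<^sub>R f s"
        unfolding f_def scaleR_sum_right sum_negf[symmetric]
        by (intro sum.cong) (auto split: split_indicator)
      then show ?thesis using True by simp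
    next
      case False
      then have "indicator (S k) (q + s *\<^sub>R v) = (0::real)" if "k < n" for k
        using far[of s k] that \<open>\<epsilon> < \<delta>\<close> by (auto split: split_indicator)
      then show ?thesis using False by simp
    qed
    ultimately show ?thesis
      by (intro integral_unique) (simp only: has_integral_restrict_UNIV)
  qed
  have "eventually (\<lambda>\<epsilon>. integral {s. \<bar>t - s\<bar> > \<epsilon>} (\<lambda>s. (1 / (t - s)) *\<^sub>R f s) = I) (at_right 0)"
    unfolding eventually_at_right[OF \<delta>] using \<delta> int by blast
  then have "((\<lambda>\<epsilon>. integral {s. \<bar>t - s\<bar> > \<epsilon>} (\<lambda>s. (1 / (t - s)) *\<^sub>R f s)) \<longlongrightarrow> I) (at_right 0)"
    by (rule tendsto_eventually)
  then have "Lim (at_right 0) (\<lambda>\<epsilon>. integral {s. \<bar>t - s\<bar> > \<epsilon>} (\<lambda>s. (1 / (t - s)) *\<^sub>R f s)) = I"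
    by (intro tendsto_Lim) auto
  then show ?thesis
    unfolding hilbert_transform_def f_def[symmetric] I_def by (simp add: scaleR_sum_right)
qed

text \<open>The preimage of a bounded convex set under a nonconstant affine map from the real line
  is bounded and convex, that is, a bounded interval.\<close>

lemma line_step_function:
  fixes S :: "nat \<Rightarrow> 'b::euclidean_space set"
  assumes "\<And>k. k < n \<Longrightarrow> bounded (S k)" "\<And>k. k < n \<Longrightarrow> convex (S k)" "v \<noteq> 0"
  shows "(\<lambda>s::real. \<Sum>k<n. indicator (S k) (q + s *\<^sub>R v) *\<^sub>R c k) \<in> step_functions bounded_intervals"
proof -
  have "{s::real. q + s *\<^sub>R v \<in> S k} \<in> bounded_intervals" if k: "k < n" for k
  proof -
    have convex: "convex {s. q + s *\<^sub>R v \<in> S k}"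
    proof (rule convexI)
      fix x y a b :: real
      assume "x \<in> {s. q + s *\<^sub>R v \<in> S k}" "y \<in> {s. q + s *\<^sub>R v \<in> S k}" and ab: "0 \<le> a" "0 \<le> b" "a + b = 1"
      then have "a *\<^sub>R (q + x *\<^sub>R v) + b *\<^sub>R (q + y *\<^sub>R v) \<in> S k"
        using assms(2)[OF k] by (auto intro: convexD)
      also have "a *\<^sub>R (q + x *\<^sub>R v) + b *\<^sub>R (q + y *\<^sub>R v) = (a + b) *\<^sub>R q + (a * x + b * y) *\<^sub>R v"
        by (simp add: algebra_simps)
      finally show "a *\<^sub>R x + b *\<^sub>R y \<in> {s. q + s *\<^sub>R v \<in> S k}"
        using ab by simp
    qed
    obtain B where B: "\<And>x. x \<in> S k \<Longrightarrow> norm x \<le> B"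
      using assms(1)[OF k] unfolding bounded_iff by blast
    have "\<bar>s\<bar> \<le> (B + norm q) / norm v" if "q + s *\<^sub>R v \<in> S k" for s
    proof -
      have "norm (s *\<^sub>R v) \<le> norm (q + s *\<^sub>R v) + norm q"
        using norm_triangle_ineq4[of "q + s *\<^sub>R v" q] by simp
      then show ?thesis using B[OF that] assms(3) by (simp add: field_simps)
    qed
    then have "bounded {s. q + s *\<^sub>R v \<in> S k}"
      unfolding bounded_iff by auto
    then show ?thesis
      using convex unfolding bounded_intervals_def by (simp add: is_interval_convex_1)
  qed
  then show ?thesis
    unfolding step_functions_def
    by (auto intro!: exI[of _ n] exI[of _ "\<lambda>k. {s. q + s *\<^sub>R v \<in> S k}"] exI[of _ c] simp: indicator_def)
qed

text \<open>Both sides are decomposed into integrals over lines in direction \<open>v\<close>, and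
  the one-dimensional estimate is applied to the restriction to each line. On the left only the part
  of the line below the hyperplane is kept; there the transform is a ray sum up to a sign, which
  evenness of \<open>\<Psi>\<close> absorbs. The right-hand integral extends over the whole
  space.\<close>

lemma transference:
  fixes S :: "nat \<Rightarrow> (real ^ 'd::finite) set" and c :: "nat \<Rightarrow> 'a::banach"
  assumes S: "\<And>k. k < n \<Longrightarrow> S k \<in> sets borel" "\<And>k. k < n \<Longrightarrow> bounded (S k)"
      "\<And>k. k < n \<Longrightarrow> S k \<subseteq> pos_halfspace j" "\<And>k. k < n \<Longrightarrow> convex (S k)"
    and v: "v $ j > 0"
    and cont: "continuous_on UNIV \<Phi>" "continuous_on UNIV \<Psi>" and even: "\<And>x. \<Psi> (- x) = \<Psi> x"
    and H: "\<And>g. g \<in> step_functions bounded_intervals \<Longrightarrow>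
      (\<integral>\<^sup>+s. ennreal (\<Psi> (hilbert_transform g s)) \<partial>lborel) \<le> C * (\<integral>\<^sup>+s. ennreal (\<Phi> (g s)) \<partial>lborel)"
  shows "(\<integral>\<^sup>+q. indicator {q. q $ j < 0} q * ennreal (\<Psi> (\<Sum>k<n. ray_hilbert (S k) q v *\<^sub>R c k)) \<partial>lborel)
    \<le> C * (\<integral>\<^sup>+q. ennreal (\<Phi> (\<Sum>k<n. indicator (S k) q *\<^sub>R c k)) \<partial>lborel)"
proof -
  let ?Q = "{q. 0 \<le> q $ j \<and> q $ j < v $ j}"
  define F where "F q = indicator {q. q $ j < 0} q * ennreal (\<Psi> (\<Sum>k<n. ray_hilbert (S k) q v *\<^sub>R c k))" for q
  define E where "E q = ennreal (\<Phi> (\<Sum>k<n. indicator (S k) q *\<^sub>R c k))" for q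
  define g where "g q s = (\<Sum>k<n. indicator (S k) (q + s *\<^sub>R v) *\<^sub>R c k)" for q s
  have "(\<lambda>q. \<Psi> (\<Sum>k<n. ray_hilbert (S k) q v *\<^sub>R c k)) \<in> borel_measurable borel"
    using S(1) cont(2) by (intro borel_measurable_continuous_combination) auto
  then have F: "F \<in> borel_measurable borel" unfolding F_def by measurable
  have "(\<lambda>q. \<Phi> (\<Sum>k<n. indicator (S k) q *\<^sub>R c k)) \<in> borel_measurable borel"
    using S(1) cont(1) by (intro borel_measurable_continuous_combination) auto
  then have E [measurable]: "E \<in> borel_measurable borel" unfolding E_def by measurable
  have "(\<integral>\<^sup>+q. F q \<partial>lborel) = (\<integral>\<^sup>+q. indicator ?Q q * (\<integral>\<^sup>+t. F (q + t *\<^sub>R v) \<partial>lborel) \<partial>lborel)"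
    by (rule nn_integral_lines[OF F v])
  also have "\<dots> \<le> (\<integral>\<^sup>+q. indicator ?Q q * (C * (\<integral>\<^sup>+t. E (q + t *\<^sub>R v) \<partial>lborel)) \<partial>lborel)"
  proof (intro nn_integral_mono mult_left_mono)
    fix q
    have "F (q + t *\<^sub>R v) \<le> ennreal (\<Psi> (hilbert_transform (g q) t))" for t
    proof (cases "(q + t *\<^sub>R v) $ j < 0")
      case True
      have "hilbert_transform (g q) t = - (\<Sum>k<n. ray_hilbert (S k) (q + t *\<^sub>R v) v *\<^sub>R c k)"
        unfolding g_def using S True v by (intro hilbert_transform_line) auto
      then show ?thesis using True unfolding F_def by (simp add: even)
    qed (simp add: F_def)
    then have "(\<integral>\<^sup>+t. F (q + t *\<^sub>R v) \<partial>lborel) \<le> (\<integral>\<^sup>+t. ennreal (\<Psi> (hilbert_transform (g q) t)) \<partial>lborel)"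
      by (intro nn_integral_mono)
    also have "\<dots> \<le> C * (\<integral>\<^sup>+t. ennreal (\<Phi> (g q t)) \<partial>lborel)"
      unfolding g_def using S v by (intro H line_step_function) auto
    finally show "(\<integral>\<^sup>+t. F (q + t *\<^sub>R v) \<partial>lborel) \<le> C * (\<integral>\<^sup>+t. E (q + t *\<^sub>R v) \<partial>lborel)"
      unfolding E_def g_def .
  qed simp
  also have "\<dots> = C * (\<integral>\<^sup>+q. indicator ?Q q * (\<integral>\<^sup>+t. E (q + t *\<^sub>R v) \<partial>lborel) \<partial>lborel)"
    by (subst nn_integral_cmult[symmetric]) (auto simp: mult_ac)
  also have "\<dots> = C * (\<integral>\<^sup>+q. E q \<partial>lborel)"
    using nn_integral_lines[OF E v] by simp
  finally show ?thesis unfolding F_def E_def .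
qed

subsection \<open>The operator on the half-space\<close>

text \<open>The numerator is at most \<open>norm (x + y)\<close>, which in turn is at least
  \<open>x $ j\<close>. The upper bound does not depend on \<open>y\<close>, so the kernel is
  integrable over sets of finite measure.\<close>

lemma T_kernel_bounds:
  fixes x y :: "real ^ 'd::finite"
  assumes "x \<in> pos_halfspace j" "y \<in> pos_halfspace j"
  shows "0 \<le> T_kernel j (x + y)"
    and "T_kernel j (x + y) \<le> Gamma ((real CARD('d) + 1) / 2) / pi powr ((real CARD('d) + 1) / 2) * (1 / (x $ j) ^ CARD('d))"
proof -
  have xy: "x $ j > 0" "y $ j > 0" using assms unfolding pos_halfspace_def by auto
  have G: "Gamma ((real CARD('d) + 1) / 2) / pi powr ((real CARD('d) + 1) / 2) \<ge> 0"
    by (simp add: Gamma_real_nonneg add_nonneg_nonneg)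
  have le: "(x + y) $ j \<le> norm (x + y)"
    using component_le_norm_cart[of "x + y" j] by simp
  then have pos: "norm (x + y) \<ge> x $ j" "norm (x + y) > 0" using xy by auto
  show "0 \<le> T_kernel j (x + y)"
    unfolding T_kernel_def using G xy by (intro mult_nonneg_nonneg divide_nonneg_nonneg) auto
  have "(x + y) $ j / norm (x + y) ^ (CARD('d) + 1) \<le> norm (x + y) / norm (x + y) ^ (CARD('d) + 1)"
    using le by (intro divide_right_mono) auto
  also have "\<dots> = 1 / norm (x + y) ^ CARD('d)" using pos by simp
  also have "\<dots> \<le> 1 / (x $ j) ^ CARD('d)"
    using pos xy by (intro divide_left_mono power_mono mult_pos_pos zero_less_power) auto
  finally show "T_kernel j (x + y) \<le> Gamma ((real CARD('d) + 1) / 2) / pi powr ((real CARD('d) + 1) / 2) * (1 / (x $ j) ^ CARD('d))"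
    unfolding T_kernel_def using G by (intro mult_left_mono) auto
qed

lemma T_kernel_measurable [measurable]: "T_kernel j \<in> borel_measurable borel"
  unfolding T_kernel_def by measurable

text \<open>The scalar value at \<open>x\<close> of the operator on the indicator of
  \<open>S\<close>. Integrating over \<open>UNIV\<close> is the same as over the half-space when
  \<open>S\<close> lies in it.\<close>

definition T_coeff :: "'d::finite \<Rightarrow> (real ^ 'd) set \<Rightarrow> real ^ 'd \<Rightarrow> real" where
  "T_coeff j S x = integral UNIV (\<lambda>y. T_kernel j (x + y) * indicator S y)"

text \<open>The kernel is bounded and nonnegative on the half-space and \<open>S\<close> has finite
  measure. The second form links the gauge integral in \<open>T_op\<close> to the Lebesgue integral,
  for which Tonelli's theorem is available.\<close>

lemma T_coeff:
  fixes S :: "(real ^ 'd::finite) set"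
  assumes [measurable]: "S \<in> sets borel" and "bounded S" and S: "S \<subseteq> pos_halfspace j" and x: "x \<in> pos_halfspace j"
  shows "((\<lambda>y. T_kernel j (x + y) * indicator S y) has_integral T_coeff j S x) UNIV"
    and "(\<integral>\<^sup>+y. ennreal (T_kernel j (x + y) * indicator S y) \<partial>lborel) = ennreal (T_coeff j S x)"
proof -
  have nonneg: "0 \<le> T_kernel j (x + y) * indicator S y" for y
    using T_kernel_bounds(1)[OF x, of y] S by (auto split: split_indicator)
  obtain K where K: "\<And>y. y \<in> pos_halfspace j \<Longrightarrow> T_kernel j (x + y) \<le> K"
    using T_kernel_bounds(2)[OF x] by blast
  have "(\<integral>\<^sup>+y. ennreal (T_kernel j (x + y) * indicator S y) \<partial>lborel) \<le> (\<integral>\<^sup>+y. ennreal K * indicator S y \<partial>lborel)"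
    using K S by (intro nn_integral_mono) (auto split: split_indicator intro!: ennreal_leI)
  also have "\<dots> = ennreal K * emeasure lborel S"
    by (rule nn_integral_cmult_indicator) simp
  also have "\<dots> < \<infinity>"
    using emeasure_bounded_finite[OF assms(2)] by (simp add: ennreal_mult_less_top)
  finally have "(\<lambda>y. T_kernel j (x + y) * indicator S y) integrable_on UNIV"
    using nonneg by (intro nn_integral_integrable_on) auto
  then show *: "((\<lambda>y. T_kernel j (x + y) * indicator S y) has_integral T_coeff j S x) UNIV"
    unfolding T_coeff_def by (rule integrable_integral)
  show "(\<integral>\<^sup>+y. ennreal (T_kernel j (x + y) * indicator S y) \<partial>lborel) = ennreal (T_coeff j S x)"
    by (rule nn_integral_has_integral_lborel[OF _ _ *]) (use nonneg in auto)
qed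

lemma T_coeff_nonneg:
  assumes "S \<subseteq> pos_halfspace j" "x \<in> pos_halfspace j"
  shows "0 \<le> T_coeff j S x"
proof (cases "(\<lambda>y. T_kernel j (x + y) * indicator S y) integrable_on UNIV")
  case True
  then show ?thesis
    unfolding T_coeff_def using assms T_kernel_bounds(1)[OF assms(2)]
    by (intro integral_nonneg) (auto split: split_indicator)
\<comment> \<open>A gauge integral that does not exist has the default value 0.\<close>
qed (simp add: T_coeff_def not_integrable_integral)

lemma T_op_step_function:
  fixes S :: "nat \<Rightarrow> (real ^ 'd::finite) set" and c :: "nat \<Rightarrow> 'a::banach"
  assumes S: "\<And>k. k < n \<Longrightarrow> S k \<in> sets borel" "\<And>k. k < n \<Longrightarrow> bounded (S k)" "\<And>k. k < n \<Longrightarrow> S k \<subseteq> pos_halfspace j"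
    and x: "x \<in> pos_halfspace j"
  shows "T_op j (\<lambda>y. \<Sum>k<n. indicator (S k) y *\<^sub>R c k) x = (\<Sum>k<n. T_coeff j (S k) x *\<^sub>R c k)"
proof -
  define G where "G = Gamma ((real CARD('d) + 1) / 2) / pi powr ((real CARD('d) + 1) / 2)"
  define f where "f y = (\<Sum>k<n. indicator (S k) y *\<^sub>R c k)" for y
  have f0: "f y = 0" if "y \<notin> pos_halfspace j" for y
    unfolding f_def using that S(3) by (intro sum.neutral) (auto split: split_indicator)
  have "((\<lambda>y. \<Sum>k<n. (T_kernel j (x + y) * indicator (S k) y) *\<^sub>R c k) has_integral (\<Sum>k<n. T_coeff j (S k) x *\<^sub>R c k)) UNIV"
    using S x by (intro has_integral_sum has_integral_scaleR_left T_coeff) auto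
  also have "(\<lambda>y. \<Sum>k<n. (T_kernel j (x + y) * indicator (S k) y) *\<^sub>R c k) = (\<lambda>y. T_kernel j (x + y) *\<^sub>R f y)"
    unfolding f_def scaleR_sum_right by simp
  also have "\<dots> = (\<lambda>y. if y \<in> pos_halfspace j then T_kernel j (x + y) *\<^sub>R f y else 0)"
    using f0 by auto
  finally have "((\<lambda>y. T_kernel j (x + y) *\<^sub>R f y) has_integral (\<Sum>k<n. T_coeff j (S k) x *\<^sub>R c k)) (pos_halfspace j)"
    unfolding has_integral_restrict_UNIV .
  then have "integral (pos_halfspace j) (\<lambda>y. T_kernel j (x + y) *\<^sub>R f y) = (\<Sum>k<n. T_coeff j (S k) x *\<^sub>R c k)"
    by (rule integral_unique)
  moreover have "T_kernel j (x + y) *\<^sub>R f y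
      = G *\<^sub>R (((x $ j + y $ j) / norm (x + y) ^ (CARD('d) + 1)) *\<^sub>R f y)" for y
    unfolding T_kernel_def G_def by simp
  ultimately show ?thesis
    unfolding T_op_def G_def[symmetric] f_def[symmetric] by (simp only: integral_cmul)
qed

definition rotation_measure :: "'d::finite \<Rightarrow> (real ^ 'd) measure" where
  "rotation_measure j = density lborel (\<lambda>v. ennreal (rotation_density j v))"

lemma prob_space_rotation_measure: "prob_space (rotation_measure j)"
  unfolding rotation_measure_def
  by (rule prob_spaceI) (simp add: emeasure_density nn_integral_rotation_density)

text \<open>This is the averaged kernel identity divided by \<open>pi\<close>: each coefficient of
  \<open>T_op\<close> on a step function is the mean of a directional transform, as Jensen's
  inequality requires.\<close>

lemma ray_hilbert_rotation:
  fixes S :: "(real ^ 'd::finite) set"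
  assumes S: "S \<in> sets borel" "bounded S" "S \<subseteq> pos_halfspace j" and x: "x \<in> pos_halfspace j"
  shows "integrable (rotation_measure j) (ray_hilbert S (- x))"
    and "integral\<^sup>L (rotation_measure j) (ray_hilbert S (- x)) = T_coeff j S x"
proof -
  have [measurable]: "S \<in> sets borel" by fact
  have "- x $ j < 0" using x unfolding pos_halfspace_def by simp
  \<comment> \<open>Finiteness holds for every \<open>v\<close>, including directions that do not
    point into the half-space, so the real value recovers the ray integral everywhere.\<close>
  then have pi: "ennreal (pi * ray_hilbert S (- x) v) = ray_integral S (- x) v" for v
    using ray_integral_finite[OF S(2,3), of "- x" v] unfolding ray_hilbert_def by (simp add: less_top)
  have "ennreal pi * (\<integral>\<^sup>+v. ennreal (ray_hilbert S (- x) v) \<partial>rotation_measure j)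
      = (\<integral>\<^sup>+v. ennreal (rotation_density j v) * ray_integral S (- x) v \<partial>lborel)"
    unfolding rotation_measure_def pi[symmetric]
    by (simp add: nn_integral_density nn_integral_cmult[symmetric] ennreal_mult' mult_ac)
  also have "\<dots> = (\<integral>\<^sup>+y. ennreal (pi * T_kernel j (x + y)) * indicator S y \<partial>lborel)"
    using S x by (intro rotation_average) auto
  also have "\<dots> = (\<integral>\<^sup>+y. ennreal pi * ennreal (T_kernel j (x + y) * indicator S y) \<partial>lborel)"
    by (intro nn_integral_cong) (auto simp: ennreal_mult' split: split_indicator)
  also have "\<dots> = ennreal pi * ennreal (T_coeff j S x)"
    using T_coeff(2)[OF S x] by (simp add: nn_integral_cmult)
  finally have eq: "(\<integral>\<^sup>+v. ennreal (ray_hilbert S (- x) v) \<partial>rotation_measure j) = ennreal (T_coeff j S x)"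
    by (simp add: ennreal_mult_cancel_left)
  have meas: "ray_hilbert S (- x) \<in> borel_measurable (rotation_measure j)"
    unfolding rotation_measure_def by measurable
  have nonneg: "0 \<le> ray_hilbert S (- x) v" for v unfolding ray_hilbert_def by simp
  show "integrable (rotation_measure j) (ray_hilbert S (- x))"
    using meas nonneg eq by (intro integrableI_nonneg) auto
  show "integral\<^sup>L (rotation_measure j) (ray_hilbert S (- x)) = T_coeff j S x"
    using meas nonneg eq T_coeff_nonneg[OF S(3) x] by (subst integral_eq_nn_integral) auto
qed

text \<open>Jensen's inequality is applied at each \<open>x\<close>, Tonelli's theorem exchanges
  \<open>x\<close> and \<open>v\<close>, and transference bounds the integral over \<open>x\<close>
  by the same quantity for every \<open>v\<close> of positive density. The density has total mass 1,
  so the constant survives. The right-hand side is still an integral over the whole space.\<close>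

lemma T_op_bound_bounded:
  fixes S :: "nat \<Rightarrow> (real ^ 'd::finite) set" and c :: "nat \<Rightarrow> 'a::banach"
  assumes S: "\<And>k. k < n \<Longrightarrow> S k \<in> sets borel" "\<And>k. k < n \<Longrightarrow> bounded (S k)"
      "\<And>k. k < n \<Longrightarrow> S k \<subseteq> pos_halfspace j" "\<And>k. k < n \<Longrightarrow> convex (S k)"
    and cont: "continuous_on UNIV \<Phi>" "continuous_on UNIV \<Psi>" and even: "\<And>x. \<Psi> (- x) = \<Psi> x"
    and nonneg: "\<And>x. 0 \<le> \<Psi> x" and conv: "convex_on UNIV \<Psi>"
    and H: "\<And>g. g \<in> step_functions bounded_intervals \<Longrightarrow>
      (\<integral>\<^sup>+s. ennreal (\<Psi> (hilbert_transform g s)) \<partial>lborel) \<le> C * (\<integral>\<^sup>+s. ennreal (\<Phi> (g s)) \<partial>lborel)"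
  defines "f \<equiv> (\<lambda>y. \<Sum>k<n. indicator (S k) y *\<^sub>R c k)"
  shows "(\<integral>\<^sup>+x\<in>pos_halfspace j. ennreal (\<Psi> (T_op j f x)) \<partial>lborel) \<le> C * (\<integral>\<^sup>+x. ennreal (\<Phi> (f x)) \<partial>lborel)"
proof -
  define P where "P x v = ennreal (\<Psi> (\<Sum>k<n. ray_hilbert (S k) (- x) v *\<^sub>R c k))" for x v
  have [measurable]: "pos_halfspace j \<in> sets borel" unfolding pos_halfspace_def by measurable
  have P [measurable]: "case_prod P \<in> borel_measurable (borel \<Otimes>\<^sub>M borel)"
  proof -
    have "(\<lambda>z. \<Psi> (\<Sum>k<n. ray_hilbert (S k) (- fst z) (snd z) *\<^sub>R c k)) \<in> borel_measurable (borel \<Otimes>\<^sub>M borel)"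
    proof (rule borel_measurable_continuous_combination[OF _ cont(2)])
      fix k assume "k < n"
      then have [measurable]: "S k \<in> sets borel" by (rule S)
      show "(\<lambda>z. ray_hilbert (S k) (- fst z) (snd z)) \<in> borel_measurable (borel \<Otimes>\<^sub>M borel)" by measurable
    qed
    then show ?thesis unfolding P_def case_prod_beta by measurable
  qed
  have "(\<integral>\<^sup>+x\<in>pos_halfspace j. ennreal (\<Psi> (T_op j f x)) \<partial>lborel)
      \<le> (\<integral>\<^sup>+x. indicator (pos_halfspace j) x * (\<integral>\<^sup>+v. ennreal (rotation_density j v) * P x v \<partial>lborel) \<partial>lborel)"
  proof (intro nn_integral_mono)
    fix x
    show "ennreal (\<Psi> (T_op j f x)) * indicator (pos_halfspace j) x
      \<le> indicator (pos_halfspace j) x * (\<integral>\<^sup>+v. ennreal (rotation_density j v) * P x v \<partial>lborel)"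
    proof (cases "x \<in> pos_halfspace j")
      case True
      have ray: "integrable (rotation_measure j) (ray_hilbert (S k) (- x))" if "k < n" for k
        by (rule ray_hilbert_rotation(1)[OF S(1-3)[OF that] True])
      have ray: "integrable (rotation_measure j) (ray_hilbert (S k) (- x))" if "k < n" for k
        by (rule ray_hilbert_rotation(1)[OF S(1-3)[OF that] True])
      have "T_op j f x = (\<Sum>k<n. integral\<^sup>L (rotation_measure j) (ray_hilbert (S k) (- x)) *\<^sub>R c k)"
        unfolding f_def using S True
        by (subst T_op_step_function) (auto intro!: sum.cong simp: ray_hilbert_rotation)
      also have "ennreal (\<Psi> \<dots>) \<le> (\<integral>\<^sup>+v. P x v \<partial>rotation_measure j)"
        unfolding P_def
        by (rule prob_space.jensens_inequality_combination[OF prob_space_rotation_measure conv cont(2) nonneg ray])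
      also have "\<dots> = (\<integral>\<^sup>+v. ennreal (rotation_density j v) * P x v \<partial>lborel)"
        unfolding rotation_measure_def by (simp add: nn_integral_density)
      finally show ?thesis using True by simp
    qed simp
  qed
  also have "\<dots> = (\<integral>\<^sup>+x. \<integral>\<^sup>+v. indicator (pos_halfspace j) x * (ennreal (rotation_density j v) * P x v) \<partial>lborel \<partial>lborel)"
    by (simp add: nn_integral_cmult)
  also have "\<dots> = (\<integral>\<^sup>+v. \<integral>\<^sup>+x. indicator (pos_halfspace j) x * (ennreal (rotation_density j v) * P x v) \<partial>lborel \<partial>lborel)"
    by (rule lborel_pair.Fubini') measurable
  also have "\<dots> = (\<integral>\<^sup>+v. ennreal (rotation_density j v) * (\<integral>\<^sup>+x. indicator (pos_halfspace j) x * P x v \<partial>lborel) \<partial>lborel)"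
    by (subst nn_integral_cmult[symmetric]) (auto simp: mult_ac)
  also have "\<dots> \<le> (\<integral>\<^sup>+v. ennreal (rotation_density j v) * (C * (\<integral>\<^sup>+x. ennreal (\<Phi> (f x)) \<partial>lborel)) \<partial>lborel)"
  proof (rule nn_integral_mono)
    fix v :: "real ^ 'd"
    show "ennreal (rotation_density j v) * (\<integral>\<^sup>+x. indicator (pos_halfspace j) x * P x v \<partial>lborel)
      \<le> ennreal (rotation_density j v) * (C * (\<integral>\<^sup>+x. ennreal (\<Phi> (f x)) \<partial>lborel))"
    proof (cases "v $ j > 0")
      case True
      have "(\<lambda>x. indicator (pos_halfspace j) x * P x v) \<in> borel_measurable borel" by measurable
      \<comment> \<open>The reflection of \<open>x\<close> in the origin carries the half-space to
        the lower one, where transference is formulated.\<close>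
      then have "(\<integral>\<^sup>+x. indicator (pos_halfspace j) x * P x v \<partial>lborel)
          = (\<integral>\<^sup>+x. indicator (pos_halfspace j) (- x) * P (- x) v \<partial>lborel)"
        by (subst nn_integral_lborel_affine[where t = 0 and c = "-1"]) auto
      also have "\<dots> = (\<integral>\<^sup>+q. indicator {q. q $ j < 0} q * ennreal (\<Psi> (\<Sum>k<n. ray_hilbert (S k) q v *\<^sub>R c k)) \<partial>lborel)"
        by (intro nn_integral_cong) (simp add: P_def pos_halfspace_def indicator_def)
      also have "\<dots> \<le> C * (\<integral>\<^sup>+q. ennreal (\<Phi> (f q)) \<partial>lborel)"
        unfolding f_def using S by (intro transference[OF _ _ _ _ True cont even H]) auto
      finally show ?thesis by (intro mult_left_mono) auto
    \<comment> \<open>Directions with nonpositive \<open>j\<close>-th coordinate have density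
      0.\<close>
    qed (simp add: rotation_density_def)
  qed
  also have "\<dots> = C * (\<integral>\<^sup>+x. ennreal (\<Phi> (f x)) \<partial>lborel)"
    by (subst nn_integral_multc) (auto simp: nn_integral_rotation_density)
  finally show ?thesis .
qed

text \<open>An open interval of finite measure would be bounded, but the half-space contains
  arbitrarily long multiples of the \<open>j\<close>-th unit vector.\<close>

lemma emeasure_pos_halfspace: "emeasure lborel (pos_halfspace (j::'d::finite)) = \<infinity>"
proof (rule ccontr)
  assume "emeasure lborel (pos_halfspace j) \<noteq> \<infinity>"
  moreover have "open (pos_halfspace j)"
    unfolding pos_halfspace_def by (intro open_Collect_less continuous_intros)
  moreover have "is_interval (pos_halfspace j)"
    unfolding pos_halfspace_def is_interval_cart by (force dest: spec[of _ j])
  ultimately have "bounded (pos_halfspace j)"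
    by (intro bounded_open_interval) (auto simp: less_top)
  then obtain B where B: "\<And>x. x \<in> pos_halfspace j \<Longrightarrow> norm x \<le> B"
    unfolding bounded_iff by blast
  have "axis j (\<bar>B\<bar> + 1) \<in> pos_halfspace j" unfolding pos_halfspace_def by (simp add: axis_def)
  from B[OF this] show False
    using component_le_norm_cart[of "axis j (\<bar>B\<bar> + 1)" j] by simp
qed

text \<open>Outside the half-space the integrand is \<open>\<Phi> 0\<close>. If this is 0, nothing
  is lost by restricting the integral. Otherwise the half-space already contains a set of infinite
  measure on which \<open>f\<close> vanishes, and the right-hand side is infinite because
  \<open>C\<close> is nonzero.\<close>

lemma nn_integral_pos_halfspace_step_function:
  fixes S :: "nat \<Rightarrow> (real ^ 'd::finite) set" and c :: "nat \<Rightarrow> 'a::banach"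
  assumes S: "\<And>k. k < n \<Longrightarrow> S k \<in> sets borel" "\<And>k. k < n \<Longrightarrow> bounded (S k)" "\<And>k. k < n \<Longrightarrow> S k \<subseteq> pos_halfspace j"
    and nonneg: "0 \<le> \<Phi> 0" and "C \<noteq> 0"
  defines "f \<equiv> (\<lambda>y. \<Sum>k<n. indicator (S k) y *\<^sub>R c k)"
  shows "C * (\<integral>\<^sup>+x. ennreal (\<Phi> (f x)) \<partial>lborel) \<le> C * (\<integral>\<^sup>+x\<in>pos_halfspace j. ennreal (\<Phi> (f x)) \<partial>lborel)"
proof (cases "\<Phi> 0 = 0")
  case True
  have "f x = 0" if "x \<notin> pos_halfspace j" for x
    unfolding f_def using that S(3) by (intro sum.neutral) (auto split: split_indicator)
  then show ?thesis
    using True by (intro mult_left_mono nn_integral_mono) (auto split: split_indicator)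
next
  case False
  define U where "U = (\<Union>k<n. S k)"
  have U [measurable]: "U \<in> sets borel" unfolding U_def using S(1) by auto
  have half [measurable]: "pos_halfspace j \<in> sets borel" unfolding pos_halfspace_def by measurable
  have "bounded U" unfolding U_def using S(2) by auto
  then have fin: "emeasure lborel U < \<infinity>" using emeasure_bounded_finite by blast
  have "\<infinity> \<le> emeasure lborel U + emeasure lborel (pos_halfspace j - U)"
    using emeasure_mono[of "pos_halfspace j" "U \<union> (pos_halfspace j - U)" lborel]
      emeasure_subadditive[of U lborel "pos_halfspace j - U"] emeasure_pos_halfspace[of j]
    by (auto simp: top.extremum_unique)
  then have inf: "emeasure lborel (pos_halfspace j - U) = \<infinity>"
    using fin by (auto simp: top.extremum_unique)
  have "f x = 0" if "x \<notin> U" for x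
    unfolding f_def using that unfolding U_def by (intro sum.neutral) (auto split: split_indicator)
  then have "(\<integral>\<^sup>+x. ennreal (\<Phi> 0) * indicator (pos_halfspace j - U) x \<partial>lborel)
      \<le> (\<integral>\<^sup>+x\<in>pos_halfspace j. ennreal (\<Phi> (f x)) \<partial>lborel)"
    by (intro nn_integral_mono) (auto split: split_indicator)
  moreover have "(\<integral>\<^sup>+x. ennreal (\<Phi> 0) * indicator (pos_halfspace j - U) x \<partial>lborel) = \<infinity>"
    using inf False nonneg by (subst nn_integral_cmult_indicator) (auto simp: ennreal_mult_top)
  ultimately have "(\<integral>\<^sup>+x\<in>pos_halfspace j. ennreal (\<Phi> (f x)) \<partial>lborel) = \<infinity>"
    by (simp add: top.extremum_unique)
  then show ?thesis using \<open>C \<noteq> 0\<close> by (simp add: ennreal_mult_top)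
qed

text \<open>Passing from a rectangle to its interior changes it by a null set only, discards the unbounded
  rectangles of measure zero, and leaves a Borel set.\<close>

lemma T_op_bound:
  fixes f :: "real ^ 'd::finite \<Rightarrow> 'a::banach"
  assumes f: "f \<in> step_functions (halfspace_rectangles j)"
    and cont: "continuous_on UNIV \<Phi>" "continuous_on UNIV \<Psi>" and even: "\<And>x. \<Psi> (- x) = \<Psi> x"
    and nonneg: "\<And>x. 0 \<le> \<Phi> x" "\<And>x. 0 \<le> \<Psi> x" and conv: "convex_on UNIV \<Psi>"
    and H: "\<And>g. g \<in> step_functions bounded_intervals \<Longrightarrow>
      (\<integral>\<^sup>+s. ennreal (\<Psi> (hilbert_transform g s)) \<partial>lborel) \<le> C * (\<integral>\<^sup>+s. ennreal (\<Phi> (g s)) \<partial>lborel)"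
    and "C \<noteq> 0"
  shows "(\<integral>\<^sup>+x\<in>pos_halfspace j. ennreal (\<Psi> (T_op j f x)) \<partial>lborel)
    \<le> C * (\<integral>\<^sup>+x\<in>pos_halfspace j. ennreal (\<Phi> (f x)) \<partial>lborel)"
proof -
  obtain n :: nat and R c where R: "\<And>k. k < n \<Longrightarrow> R k \<in> halfspace_rectangles j"
    and f_eq: "f = (\<lambda>x. \<Sum>k<n. indicator (R k) x *\<^sub>R c k)"
    using f unfolding step_functions_def by blast
  define S where "S k = interior (R k)" for k
  define g where "g = (\<lambda>x. \<Sum>k<n. indicator (S k) x *\<^sub>R c k)"
  \<comment> \<open>Off the frontiers, membership in \<open>R k\<close> and in its interior
    coincide; frontiers of convex sets are null sets.\<close>
  define N where "N = (\<Union>k<n. frontier (R k))"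
  have S: "S k \<in> sets borel \<and> bounded (S k) \<and> S k \<subseteq> pos_halfspace j \<and> convex (S k)" if "k < n" for k
  proof -
    have k: "is_interval (R k)" "R k \<subseteq> pos_halfspace j" "emeasure lborel (R k) < \<infinity>"
      using R[OF that] unfolding halfspace_rectangles_def by auto
    have "is_interval (S k)"
      unfolding S_def using k(1) by (rule is_interval_interior)
    moreover have "emeasure lborel (S k) \<le> emeasure lborel (R k)"
      unfolding S_def using is_interval_borel[OF k(1)] by (intro emeasure_mono interior_subset) auto
    ultimately show ?thesis
      using k(2,3) interior_subset[of "R k"] bounded_open_interval[of "S k"] is_interval_convex[of "S k"]
      unfolding S_def by auto
  qed
  have "negligible N"
    unfolding N_def using R by (intro negligible_Union)
      (auto simp: halfspace_rectangles_def intro: negligible_convex_frontier is_interval_convex)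
  have fg: "f x = g x" if "x \<notin> N" for x
    unfolding f_eq g_def S_def using that unfolding N_def frontier_def
    by (intro sum.cong) (auto split: split_indicator dest: interior_subset[THEN subsetD] closure_subset[THEN subsetD])
  \<comment> \<open>The change on a null set happens under the integral sign, so the equality holds
    at every \<open>x\<close>.\<close>
  have T: "T_op j f x = T_op j g x" for x
    unfolding T_op_def
    by (intro arg_cong[where f = "scaleR _"] integral_spike[OF \<open>negligible N\<close>]) (simp add: fg)
  have "AE x in lborel. x \<notin> N"
    using \<open>negligible N\<close> unfolding negligible_iff_null_sets
    by (subst AE_completion_iff[symmetric]) (rule AE_not_in)
  then have \<Phi>: "(\<integral>\<^sup>+x\<in>pos_halfspace j. ennreal (\<Phi> (f x)) \<partial>lborel) = (\<integral>\<^sup>+x\<in>pos_halfspace j. ennreal (\<Phi> (g x)) \<partial>lborel)"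
    by (intro nn_integral_cong_AE) (auto simp: fg elim!: eventually_mono)
  have "(\<integral>\<^sup>+x\<in>pos_halfspace j. ennreal (\<Psi> (T_op j g x)) \<partial>lborel) \<le> C * (\<integral>\<^sup>+x. ennreal (\<Phi> (g x)) \<partial>lborel)"
    unfolding g_def using S cont even nonneg(2) conv H by (intro T_op_bound_bounded) auto
  also have "\<dots> \<le> C * (\<integral>\<^sup>+x\<in>pos_halfspace j. ennreal (\<Phi> (g x)) \<partial>lborel)"
    unfolding g_def using S nonneg(1) \<open>C \<noteq> 0\<close> by (intro nn_integral_pos_halfspace_step_function) auto
  finally show ?thesis unfolding T \<Phi> .
qed

theorem theorem4p41:
  fixes \<Phi> \<Psi> :: "'a::banach \<Rightarrow> real" and j :: "'d::finite"
  assumes "\<And>x. \<Phi> x \<ge> 0" and "convex_on UNIV \<Phi>" and "continuous_on UNIV \<Phi>" and "\<exists>x. \<Phi> x \<noteq> 0"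
    and "\<And>x. \<Psi> x \<ge> 0" and "convex_on UNIV \<Psi>" and "continuous_on UNIV \<Psi>" and "\<exists>x. \<Psi> x \<noteq> 0"
    and "\<And>x. \<Psi> (- x) = \<Psi> x"
  shows "T_const j \<Phi> \<Psi> \<le> hilbert_const \<Phi> \<Psi>"
  unfolding hilbert_const_def best_const_def
proof (rule Inf_greatest)
  fix C :: ennreal
  assume "C \<in> {c. \<forall>f\<in>step_functions bounded_intervals.
    (\<integral>\<^sup>+x\<in>UNIV. ennreal (\<Psi> (hilbert_transform f x)) \<partial>lborel) \<le> c * (\<integral>\<^sup>+x\<in>UNIV. ennreal (\<Phi> (f x)) \<partial>lborel)}"
  then have C: "(\<integral>\<^sup>+s. ennreal (\<Psi> (hilbert_transform g s)) \<partial>lborel) \<le> C * (\<integral>\<^sup>+s. ennreal (\<Phi> (g s)) \<partial>lborel)"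
    if "g \<in> step_functions bounded_intervals" for g
    using that by simp
  show "T_const j \<Phi> \<Psi> \<le> C"
  \<comment> \<open>Enlarging \<open>C\<close> by \<open>e\<close> makes the constant nonzero. With
    the constant 0 the convention \<open>0 * \<infinity> = 0\<close> would break the restriction of
    the right-hand integral to the half-space when \<open>\<Phi> 0 > 0\<close>.\<close>
  proof (rule ennreal_le_epsilon)
    fix e :: real assume e: "e > 0"
    have "(\<integral>\<^sup>+s. ennreal (\<Psi> (hilbert_transform g s)) \<partial>lborel) \<le> (C + ennreal e) * (\<integral>\<^sup>+s. ennreal (\<Phi> (g s)) \<partial>lborel)"
      if "g \<in> step_functions bounded_intervals" for g
      using C[OF that] by (rule order_trans) (auto intro: mult_right_mono)
    moreover have "C + ennreal e \<noteq> 0" using e by simp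
    ultimately show "T_const j \<Phi> \<Psi> \<le> C + ennreal e"
      unfolding T_const_def best_const_def using assms by (intro Inf_lower CollectI ballI T_op_bound) auto
  qed
qed

end
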